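(* Let $(X,\mathbb R^d,\mu)$ be an $m$-coloured uniformly discrete stationary ergodic point process. Let $(F,V)$ be a pattern with $V$ an open set. Then $$\liminf_{R\to\infty}\frac1{\ell(C_R)}L_{F,V}(\Lambda,C_R)=\dot\mu(X_{F,V})\qquad\text{for }\mu\text{-almost all }\Lambda\in X.$$ Similarly, if $(F,V)$ is a pattern with $V$ a closed set, then $$\limsup_{R\to\infty}\frac1{\ell(C_R)}L_{F,V}(\Lambda,C_R)=\dot\mu(X_{F,V})\qquad\text{for }\mu\text{-almost all }\Lambda\in X.$$
   Context: Fix $d,m\ge1$ and let $\mathbb E=\mathbb R^d\times\{1,\dots,m\}$ (second factor discrete), with $t+(x,i):=(t+x,i)$ for $t\in\mathbb R^d$. $C_R$ is the open cube of edge length $R$ centred at $0$ in $\mathbb R^d$; $\ell$ is Lebesgue measure. $M_p$ is the set of positive Radon measures $\lambda$ on $\mathbb E$ with $\lambda(A)\in\{0,1,2,\dots\}$ for every relatively compact Borel set $A$, with the vague topology ($\lambda_n\to\lambda$ iff $\lambda_n(f)\to\lambda(f)$ for all $f\in C_c(\mathbb E)$) and its Borel $\sigma$-algebra; $\mathbb R^d$ acts by $(T_t\lambda)(A)=\lambda(-t+A)$. For $r>0$, $M_p(C_r^{(m)},1)$ is the (compact) set of $\lambda\in M_p$ with $\lambda((a+C_r)\times\{1,\dots,m\})\le1$ for all $a\in\mathbb R^d$. An $m$-coloured uniformly discrete stationary ergodic point process $(X,\mathbb R^d,\mu)$ is a Borel probability measure $\mu$ on $M_p$, invariant and ergodic under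 all $T_t$, whose support $X$ is a closed subset of $M_p(C_r^{(m)},1)$ for some $r>0$ (fixed); it is assumed that for each colour $i$ the constant $I^{(i)}$ with $\int_X\lambda(A\times\{i\})\,d\mu(\lambda)=I^{(i)}\ell(A)$ is positive. Each $\lambda\in X$ equals $\sum_{x\in\Lambda}\delta_x$ for a set $\Lambda\subset\mathbb E$ with which it is identified. For $\Lambda\subset\mathbb E$ and $B\subset\mathbb R^d$: $B+\Lambda=\bigcup_{b\in B}(b+\Lambda)\subset\mathbb E$ and $\Lambda^\downarrow=\{x\in\mathbb R^d:(x,i)\in\Lambda\text{ for some }i\}$. $\mathcal D_r^{(m)}$ is the family of $\Lambda\subset\mathbb E$ such that for every $a\in\mathbb R^d$ there is at most one $(x,i)\in\Lambda$ with $x\in a+C_r$. A pattern is a pair $(F,V)$ where $F\in\mathcal D_r^{(m)}$ is finite with $0\in F^\downarrow$ and $V$ is a bounded measurable neighbourhood of $0$ in $\mathbb R^d$. Put $X_{F,V}=\{\Lambda\in X: F\subset V+\Lambda\}$ (inclusion respecting colour), and for bounded $B\subset\mathbb R^d$ $$L_{F,V}(\Lambda,B)=\mathrm{card}\{x\in\Lambda^\downarrow: F\subset -x+V+\Lambda,\ x-V+F^\downarrow\subset B\}.$$ $\dot\mu$ is the Palm measure of the process (all colours given weight $1$): $\dot\mu(D)=\frac1{\ell(B)}\int_X\sum_{x\in B\cap\Lambda^\downarrow}\mathbf 1_D(-x+\Lambda)\,d\mu(\Lambda)$ for Borel $D\subset X$, independent of the choice of bounded Borel $B\subset\mathbb R^d$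 with $\ell(B)>0$. *)

theory Defs
  imports "HOL-Probability.Probability"
begin

(* The coloured space R^d x {1,...,m} is a clopen subset of the type (real^'d) \<times> nat, where nat
   carries its discrete topology. *)

definition colour_space :: "nat \<Rightarrow> ((real^'d) \<times> nat) set" where
  "colour_space m = UNIV \<times> {1..m}"

definition cube :: "real \<Rightarrow> (real^'d) set" where
  "cube R = {x. \<forall>i. \<bar>x $ i\<bar> < R / 2}"

definition shift :: "real^'d \<Rightarrow> (real^'d) \<times> nat \<Rightarrow> (real^'d) \<times> nat" where
  "shift t p = (t + fst p, snd p)"

(* B + Lam, for B a subset of R^d and Lam a subset of the coloured space *)
definition set_shift :: "(real^'d) set \<Rightarrow> ((real^'d) \<times> nat) set \<Rightarrow> ((real^'d) \<times> nat) set" where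
  "set_shift B Lam = (\<Union>b\<in>B. shift b ` Lam)"

definition down :: "((real^'d) \<times> nat) set \<Rightarrow> (real^'d) set" where
  "down Lam = {x. \<exists>i. (x, i) \<in> Lam}"


subsection \<open>Integer-valued Radon measures and the vague topology\<close>

definition radon_measure :: "nat \<Rightarrow> ((real^'d) \<times> nat) measure \<Rightarrow> bool" where
  "radon_measure m lam \<longleftrightarrow>
     space lam = colour_space m \<and>
     sets lam = sets (restrict_space borel (colour_space m)) \<and>
     (\<forall>K. compact K \<and> K \<subseteq> colour_space m \<longrightarrow> emeasure lam K < \<infinity>) \<and>
     (\<forall>A\<in>sets lam. emeasure lam A = (SUP K\<in>{K. compact K \<and> K \<subseteq> A}. emeasure lam K))"

(* colour_space m is closed in the ambient type, so relative compactness in it is compactness of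
   the ambient closure. *)
definition Mp :: "nat \<Rightarrow> ((real^'d) \<times> nat) measure set" where
  "Mp m = {lam. radon_measure m lam \<and>
                (\<forall>A\<in>sets lam. compact (closure A) \<longrightarrow> emeasure lam A \<in> \<nat>)}"

definition Cc :: "nat \<Rightarrow> ((real^'d) \<times> nat \<Rightarrow> real) set" where
  "Cc m = {f. continuous_on (colour_space m) f \<and>
              compact (closure {p \<in> colour_space m. f p \<noteq> 0})}"

definition vague_topology :: "nat \<Rightarrow> ((real^'d) \<times> nat) measure topology" where
  "vague_topology m =
     topology_generated_by
       {{lam \<in> Mp m. integral\<^sup>L lam f \<in> U} | f U. f \<in> Cc m \<and> open U}"

definition vague_borel :: "nat \<Rightarrow> ((real^'d) \<times> nat) measure measure" where
  "vague_borel m = sigma (Mp m) {U. openin (vague_topology m) U}"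

lemma topspace_vague_topology: "topspace (vague_topology m) = Mp m"
proof -
  have "(\<lambda>_. 0) \<in> Cc m"
    by (simp add: Cc_def)
  then have "Mp m \<in> {{lam \<in> Mp m. integral\<^sup>L lam f \<in> U} | f U. f \<in> Cc m \<and> open U}"
    by (intro CollectI exI[of _ "\<lambda>_. 0"] exI[of _ UNIV]) auto
  then show ?thesis
    unfolding vague_topology_def topology_generated_by_topspace by blast
qed

(* T_t: since the pushforward of lam under p \<mapsto> t + p gives A the mass lam (-t + A) *)
definition translate :: "real^'d \<Rightarrow> ((real^'d) \<times> nat) measure \<Rightarrow> ((real^'d) \<times> nat) measure" where
  "translate t lam = distr lam lam (shift t)"

definition Mp_ud :: "nat \<Rightarrow> real \<Rightarrow> ((real^'d) \<times> nat) measure set" where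
  "Mp_ud m r = {lam \<in> Mp m. \<forall>a. emeasure lam (((+) a ` cube r) \<times> {1..m}) \<le> 1}"

(* The point set Lam identified with a measure lam = sum of the Dirac masses at the points of Lam *)
definition points :: "((real^'d) \<times> nat) measure \<Rightarrow> ((real^'d) \<times> nat) set" where
  "points lam = {p \<in> space lam. 0 < emeasure lam {p}}"

lemma points_eqI:
  assumes "lam \<in> Mp m" "Lam \<subseteq> colour_space m"
    and "\<And>A. A \<in> sets lam \<Longrightarrow> emeasure lam A = emeasure (count_space UNIV) (A \<inter> Lam)"
  shows "points lam = Lam"
proof -
  have sp: "space lam = colour_space m"
    and se: "sets lam = sets (restrict_space borel (colour_space m))"
    using assms(1) by (auto simp: Mp_def radon_measure_def)
  have "{p} \<in> sets lam" if "p \<in> colour_space m" for p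
  proof -
    have "{p} = colour_space m \<inter> {p}" using that by auto
    then show ?thesis
      unfolding se sets_restrict_space by (metis borel_singleton imageI sets.empty_sets)
  qed
  then have "0 < emeasure lam {p} \<longleftrightarrow> p \<in> Lam" if "p \<in> colour_space m" for p
    using that by (cases "p \<in> Lam") (simp_all add: assms(3))
  then show ?thesis
    using assms(2) unfolding points_def sp by auto
qed


subsection \<open>Uniformly discrete stationary ergodic point processes\<close>

(* The smallest closed set of full measure *)
definition is_support ::
  "nat \<Rightarrow> ((real^'d) \<times> nat) measure measure \<Rightarrow> ((real^'d) \<times> nat) measure set \<Rightarrow> bool" where
  "is_support m mu X \<longleftrightarrow>
     closedin (vague_topology m) X \<and> emeasure mu (Mp m - X) = 0 \<and>
     (\<forall>C. closedin (vague_topology m) C \<and> emeasure mu (Mp m - C) = 0 \<longrightarrow> X \<subseteq> C)"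

definition stationary :: "((real^'d) \<times> nat) measure measure \<Rightarrow> bool" where
  "stationary mu \<longleftrightarrow>
     (\<forall>t. \<forall>D\<in>sets mu. emeasure mu {lam \<in> space mu. translate t lam \<in> D} = emeasure mu D)"

definition ergodic :: "((real^'d) \<times> nat) measure measure \<Rightarrow> bool" where
  "ergodic mu \<longleftrightarrow>
     (\<forall>D\<in>sets mu. (\<forall>t. {lam \<in> space mu. translate t lam \<in> D} = D) \<longrightarrow>
        emeasure mu D = 0 \<or> emeasure mu D = 1)"

definition coloured_ergodic_point_process ::
  "nat \<Rightarrow> real \<Rightarrow> ((real^'d) \<times> nat) measure set \<Rightarrow> ((real^'d) \<times> nat) measure measure \<Rightarrow> bool" where
  "coloured_ergodic_point_process m r X mu \<longleftrightarrow>
     prob_space mu \<and> space mu = Mp m \<and> sets mu = sets (vague_borel m) \<and>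
     stationary mu \<and> ergodic mu \<and>
     is_support m mu X \<and> X \<subseteq> Mp_ud m r \<and>
     (\<forall>i\<in>{1..m}. \<exists>I::real. 0 < I \<and>
        (\<forall>A\<in>sets borel. (\<integral>\<^sup>+lam\<in>X. emeasure lam (A \<times> {i}) \<partial>mu) = ennreal I * emeasure lborel A))"

(* The Palm measure as a function of the Borel subset D of X, computed with the reference set B.
   The inner integral is the sum over the points of the process in B. *)
definition palm ::
  "((real^'d) \<times> nat) measure measure \<Rightarrow> ((real^'d) \<times> nat) measure set \<Rightarrow> (real^'d) set \<Rightarrow>
   ((real^'d) \<times> nat) measure set \<Rightarrow> ennreal" where
  "palm mu X B D =
     (\<integral>\<^sup>+lam\<in>X. (\<integral>\<^sup>+x. indicator D (translate (- x) lam)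
                   \<partial>count_space (B \<inter> down (points lam))) \<partial>mu)
     / emeasure lborel B"


subsection \<open>Patterns\<close>

definition unif_discrete :: "nat \<Rightarrow> real \<Rightarrow> ((real^'d) \<times> nat) set set" where
  "unif_discrete m r =
     {Lam. Lam \<subseteq> colour_space m \<and>
           (\<forall>a. \<exists>\<^sub>\<le>\<^sub>1p. p \<in> Lam \<and> fst p \<in> (+) a ` cube r)}"

definition is_pattern :: "nat \<Rightarrow> real \<Rightarrow> ((real^'d) \<times> nat) set \<Rightarrow> (real^'d) set \<Rightarrow> bool" where
  "is_pattern m r F V \<longleftrightarrow>
     F \<in> unif_discrete m r \<and> finite F \<and> 0 \<in> down F \<and>
     bounded V \<and> V \<in> sets borel \<and> 0 \<in> interior V"

definition pattern_set ::
  "((real^'d) \<times> nat) measure set \<Rightarrow> ((real^'d) \<times> nat) set \<Rightarrow> (real^'d) set \<Rightarrow>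
   ((real^'d) \<times> nat) measure set" where
  "pattern_set X F V = {lam \<in> X. F \<subseteq> set_shift V (points lam)}"

(* L_{F,V}(Lam, B); the second condition is x - V + down F \<subseteq> B. *)
definition pattern_count ::
  "((real^'d) \<times> nat) set \<Rightarrow> (real^'d) set \<Rightarrow> ((real^'d) \<times> nat) set \<Rightarrow> (real^'d) set \<Rightarrow> nat" where
  "pattern_count F V Lam B =
     card {x \<in> down Lam. F \<subseteq> set_shift ((\<lambda>v. - x + v) ` V) Lam \<and>
                         {x - v + f | v f. v \<in> V \<and> f \<in> down F} \<subseteq> B}"

end

(* Points of the process at which the pattern occurs form a stationary point set S with bounded
   local counts. For such a set, the averages of card (S \<inter> box) over growing boxes converge almost
   surely: one applies Birkhoff's theorem in one coordinate direction after the other, each time to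
   a bounded, almost surely convergent sequence of functions. The limit is translation invariant,
   hence constant by ergodicity, and equals the expected number of points of S in the unit box.
   Uniqueness of Haar measure identifies this number with the Palm measure of the pattern set.
   The condition that the whole pattern lie in the cube only affects points near the boundary.
   Thus the limit exists for every Borel set V, open and closed ones included. *)

theory Submission
  imports Defs "HOL-Real_Asymp.Real_Asymp"
begin

section \<open>Birkhoff averages of bounded functions\<close>

text \<open>Averages in a further direction are taken of normalised counts that still depend on the
  box size, so Birkhoff's theorem for one fixed function does not suffice.
  \<open>birkhoff_varying\<close> replaces it; boundedness of the counts, a consequence of uniform
  discreteness, makes its error terms integrable. The limit obtained is determined only up to null
  sets, whereas \<open>ergodic\<close> speaks of exactly invariant sets; a limsup of box counts,
  defined at every configuration, serves as its invariant version. The other obstacle is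
  measurability. The vague topology only controls integrals of continuous test functions, while an
  occurrence quantifies over random points and a Borel set \<open>V\<close>. Masses of open sets are
  suprema of such integrals, Borel sets follow by Dynkin's argument, and occurrences are written
  through finite sums over the points in a large window.\<close>

lemma (in prob_space) integrable_bounded_measurable:
  fixes f :: "'a \<Rightarrow> real"
  assumes "f \<in> borel_measurable M" "\<And>x. x \<in> space M \<Longrightarrow> \<bar>f x\<bar> \<le> C"
  shows "integrable M f"
  using assms by (intro integrable_const_bound[of _ C]) auto

locale measure_preserving_map = prob_space M for M :: "'a measure" +
  fixes T :: "'a \<Rightarrow> 'a"
  assumes T_measurable [measurable]: "T \<in> measurable M M"
    and distr_T: "distr M M T = M"
begin

lemma T_space: "x \<in> space M \<Longrightarrow> T x \<in> space M"
  using T_measurable by (rule measurable_space)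

lemma funpow_measurable [measurable]: "(T ^^ n) \<in> measurable M M"
  by (induction n) (auto simp: o_def)

lemma integral_comp_T:
  fixes f :: "'a \<Rightarrow> real"
  assumes "f \<in> borel_measurable M"
  shows "(\<integral>x. f (T x) \<partial>M) = (\<integral>x. f x \<partial>M)"
  using integral_distr[OF T_measurable assms] distr_T by simp

definition average :: "('a \<Rightarrow> real) \<Rightarrow> nat \<Rightarrow> 'a \<Rightarrow> real" where
  "average f n x = (\<Sum>j<n. f ((T ^^ j) x)) / real n"

lemma average_measurable [measurable]:
  assumes [measurable]: "f \<in> borel_measurable M"
  shows "average f n \<in> borel_measurable M"
  unfolding average_def by measurable

lemma funpow_space: "x \<in> space M \<Longrightarrow> (T ^^ n) x \<in> space M"
  by (induction n) (auto simp: T_space)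

lemma average_bounded:
  assumes "\<And>x. x \<in> space M \<Longrightarrow> \<bar>f x\<bar> \<le> C" "x \<in> space M"
  shows "\<bar>average f n x\<bar> \<le> C"
\<comment> \<open>Division by zero makes the empty average \<open>0\<close>, and
  \<open>0 \<le> C\<close> comes from the bound on \<open>f x\<close>.\<close>
proof (cases "n = 0")
  case True
  then show ?thesis using assms(1)[OF assms(2)] by (simp add: average_def)
next
  case False
  have "\<bar>\<Sum>j<n. f ((T ^^ j) x)\<bar> \<le> (\<Sum>j<n. C)"
    by (intro order_trans[OF sum_abs] sum_mono assms funpow_space)
  then show ?thesis using False by (simp add: average_def field_simps)
qed

text \<open>The maximum of the orbit sums of \<open>g\<close> of length at most \<open>n\<close>,
  the empty sum included. Garsia's proof of the maximal inequality works with exactly this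
  recursion.\<close>

fun maximal_sum :: "('a \<Rightarrow> real) \<Rightarrow> nat \<Rightarrow> 'a \<Rightarrow> real" where
  "maximal_sum g 0 x = 0"
| "maximal_sum g (Suc n) x = max 0 (g x + maximal_sum g n (T x))"

lemma maximal_sum_nonneg: "0 \<le> maximal_sum g n x"
  by (cases n) auto

lemma maximal_sum_Suc: "maximal_sum g n x \<le> maximal_sum g (Suc n) x"
proof (induction n arbitrary: x)
  case (Suc n)
  from Suc[of "T x"] show ?case by (auto simp: max_def)
qed auto

lemma maximal_sum_mono: "n \<le> k \<Longrightarrow> maximal_sum g n x \<le> maximal_sum g k x"
  by (rule lift_Suc_mono_le[of "\<lambda>n. maximal_sum g n x"]) (auto simp: maximal_sum_Suc simp del: maximal_sum.simps)

lemma sum_le_maximal_sum: "(\<Sum>j<n. g ((T ^^ j) x)) \<le> maximal_sum g n x"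
proof (induction n arbitrary: x)
  case (Suc n)
  have "(\<Sum>j<Suc n. g ((T ^^ j) x)) = g x + (\<Sum>j<n. g ((T ^^ j) (T x)))"
    by (subst sum.lessThan_Suc_shift) (simp add: funpow_swap1)
  then show ?case using Suc[of "T x"] by simp
qed auto

lemma maximal_sum_measurable [measurable]:
  assumes [measurable]: "g \<in> borel_measurable M"
  shows "maximal_sum g n \<in> borel_measurable M"
proof (induction n)
  case (Suc n)
  note [measurable] = Suc
  show ?case unfolding maximal_sum.simps by measurable
qed simp

lemma maximal_sum_bounded:
  assumes "\<And>x. x \<in> space M \<Longrightarrow> \<bar>g x\<bar> \<le> C" "x \<in> space M"
  shows "\<bar>maximal_sum g n x\<bar> \<le> real n * C"
  using assms(2)
proof (induction n arbitrary: x)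
  case (Suc n)
  from Suc.IH[OF T_space[OF Suc.prems]] assms(1)[OF Suc.prems]
  have a: "\<bar>maximal_sum g n (T x)\<bar> \<le> real n * C" and b: "\<bar>g x\<bar> \<le> C" by auto
  then show ?case by (auto simp: max_def distrib_right)
qed auto

text \<open>Garsia's argument: write m for \<open>maximal_sum g (Suc n)\<close>. Where m is
  positive, the recursion and monotonicity in \<open>n\<close> show that \<open>g\<close> dominates
  m minus its composition with \<open>T\<close>; elsewhere this difference is at most 0. Its
  integral vanishes because \<open>T\<close> preserves the measure.\<close>

lemma maximal_ergodic:
  fixes g :: "'a \<Rightarrow> real"
  assumes g[measurable]: "g \<in> borel_measurable M"
    and bd: "\<And>x. x \<in> space M \<Longrightarrow> \<bar>g x\<bar> \<le> C"
    and pos: "\<And>x. x \<in> space M \<Longrightarrow> \<exists>n. 0 < (\<Sum>j<n. g ((T ^^ j) x))"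
  shows "0 \<le> (\<integral>x. g x \<partial>M)"
proof -
  define E where "E n = (\<lambda>x. indicator {x. 0 < maximal_sum g n x} x :: real)" for n
  have [measurable]: "E n \<in> borel_measurable M" for n
    unfolding E_def indicator_def by measurable
  have "0 \<le> (\<integral>x. g x * E (Suc n) x \<partial>M)" for n
  proof -
    let ?m = "maximal_sum g (Suc n)"
    have i1: "integrable M ?m" "integrable M (\<lambda>x. ?m (T x))"
      using maximal_sum_bounded[of g C, OF bd] T_space
      by (intro integrable_bounded_measurable[of _ "real (Suc n) * C"]; measurable; blast)+
    have i2: "integrable M (\<lambda>x. g x * E (Suc n) x)"
      using bd by (intro integrable_bounded_measurable[of _ C])
        (measurable, auto simp: E_def indicator_def intro: order_trans[OF abs_ge_zero])
    have "0 = (\<integral>x. ?m x - ?m (T x) \<partial>M)"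
      using i1 integral_comp_T[of ?m] by (simp del: maximal_sum.simps)
    also have "\<dots> \<le> (\<integral>x. g x * E (Suc n) x \<partial>M)"
    proof (rule integral_mono)
      fix x assume "x \<in> space M"
      show "?m x - ?m (T x) \<le> g x * E (Suc n) x"
      proof (cases "0 < ?m x")
        case True
        then have "?m x = g x + maximal_sum g n (T x)" by (auto simp: max_def split: if_splits)
        then show ?thesis using True maximal_sum_Suc[of g n "T x"] by (simp add: E_def del: maximal_sum.simps)
      next
        case False
        then show ?thesis using maximal_sum_nonneg[of g "Suc n" "T x"]
          by (simp add: E_def del: maximal_sum.simps)
      qed
    qed (use i1 i2 in \<open>auto simp del: maximal_sum.simps\<close>)
    finally show ?thesis .
  qed
  \<comment> \<open>By \<open>pos\<close> every point eventually lies in the positivity sets, so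
    they exhaust the space.\<close>
  moreover have "(\<lambda>n. \<integral>x. g x * E (Suc n) x \<partial>M) \<longlonglongrightarrow> (\<integral>x. g x \<partial>M)"
  proof (rule integral_dominated_convergence[where w="\<lambda>_. C"])
    have "(\<lambda>n. g x * E (Suc n) x) \<longlonglongrightarrow> g x" if x: "x \<in> space M" for x
    proof -
      obtain n where n: "0 < (\<Sum>j<n. g ((T ^^ j) x))" using pos[OF x] by auto
      have "E (Suc k) x = 1" if "k \<ge> n" for k
      proof -
        have "0 < maximal_sum g (Suc k) x"
          using n sum_le_maximal_sum[of g x n] maximal_sum_mono[of n "Suc k" g x] that by linarith
        then show ?thesis by (simp add: E_def del: maximal_sum.simps)
      qed
      then show ?thesis
        by (intro tendsto_eventually) (auto simp: eventually_sequentially)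
    qed
    then show "AE x in M. (\<lambda>n. g x * E (Suc n) x) \<longlonglongrightarrow> g x" by auto
    show "AE x in M. norm (g x * E (Suc n) x) \<le> C" for n
    proof (rule AE_I2)
      fix x assume "x \<in> space M"
      with bd[of x] show "norm (g x * E (Suc n) x) \<le> C"
        by (auto simp: E_def indicator_def intro: order_trans[OF abs_ge_zero])
    qed
  qed auto
  ultimately show ?thesis by (intro LIMSEQ_le_const) auto
qed

section \<open>Limsup of the averages and the pointwise theorem\<close>

lemma average_Suc:
  "average f (Suc n) x = f x / real (Suc n) + average f n (T x) * (real n / real (Suc n))"
proof -
  have "(\<Sum>j<Suc n. f ((T ^^ j) x)) = f x + (\<Sum>j<n. f ((T ^^ j) (T x)))"
    by (subst sum.lessThan_Suc_shift) (simp add: funpow_swap1)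
  then show ?thesis by (simp add: average_def add_divide_distrib)
qed

text \<open>Real-valued so that it can be integrated; the default of \<open>real_of_ereal\<close> at
  infinity does not occur on the space when \<open>f\<close> is bounded, by
  \<open>limsup_average\<close>.\<close>

definition upper_average :: "('a \<Rightarrow> real) \<Rightarrow> 'a \<Rightarrow> real" where
  "upper_average f x = real_of_ereal (limsup (\<lambda>n. ereal (average f n x)))"

lemma upper_average_measurable [measurable]:
  assumes [measurable]: "f \<in> borel_measurable M"
  shows "upper_average f \<in> borel_measurable M"
  unfolding upper_average_def by measurable

context
  fixes f :: "'a \<Rightarrow> real" and C :: real
  assumes bd: "\<And>x. x \<in> space M \<Longrightarrow> \<bar>f x\<bar> \<le> C"
begin

lemma limsup_average:
  assumes x: "x \<in> space M"
  shows "limsup (\<lambda>n. ereal (average f n x)) = ereal (upper_average f x)"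
    and "\<bar>upper_average f x\<bar> \<le> C"
proof -
  have "-C \<le> average f n x" "average f n x \<le> C" for n
    using average_bounded[of f C, OF bd x, of n] by auto
  then have "limsup (\<lambda>n. ereal (average f n x)) \<le> ereal C"
    "ereal (-C) \<le> limsup (\<lambda>n. ereal (average f n x))"
    by (auto intro!: Limsup_bounded le_Limsup always_eventually)
  then show "limsup (\<lambda>n. ereal (average f n x)) = ereal (upper_average f x)"
    "\<bar>upper_average f x\<bar> \<le> C"
    unfolding upper_average_def
    by (cases "limsup (\<lambda>n. ereal (average f n x))"; auto)+
qed

text \<open>The average of length \<open>Suc n\<close> at \<open>x\<close> and the one of length
  \<open>n\<close> at \<open>T x\<close> differ by
  \<open>(f x - average f n (T x)) / real (Suc n)\<close>, which tends to 0 for bounded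
  \<open>f\<close>.\<close>

lemma upper_average_T:
  assumes x: "x \<in> space M"
  shows "upper_average f (T x) = upper_average f x"
proof -
  have "(\<lambda>n. average f (Suc n) x - average f n (T x)) \<longlonglongrightarrow> 0"
  proof (rule tendsto_rabs_zero_cancel, rule tendsto_sandwich[where f="\<lambda>_. 0" and h="\<lambda>n. 2 * C / real (Suc n)"])
    show "\<forall>\<^sub>F n in sequentially. \<bar>average f (Suc n) x - average f n (T x)\<bar> \<le> 2 * C / real (Suc n)"
    proof (intro always_eventually allI)
      fix n
      have "average f (Suc n) x - average f n (T x) = (f x - average f n (T x)) / real (Suc n)"
        unfolding average_Suc by (simp add: divide_simps) (simp add: algebra_simps)
      then show "\<bar>average f (Suc n) x - average f n (T x)\<bar> \<le> 2 * C / real (Suc n)"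
        using bd[OF x] average_bounded[of f C, OF bd T_space[OF x], of n]
        by (simp add: divide_right_mono)
    qed
    show "(\<lambda>n. 2 * C / real (Suc n)) \<longlonglongrightarrow> 0" by real_asymp
  qed auto
  then have "(\<lambda>n. ereal (average f (Suc n) x - average f n (T x))) \<longlonglongrightarrow> 0"
    by (simp add: zero_ereal_def)
  then have "limsup (\<lambda>n. ereal (average f (Suc n) x - average f n (T x)) + ereal (average f n (T x)))
      = 0 + limsup (\<lambda>n. ereal (average f n (T x)))"
    by (intro ereal_limsup_lim_add) auto
  then have "limsup (\<lambda>n. ereal (average f n (T x))) = limsup (\<lambda>n. ereal (average f (Suc n) x))"
    by simp
  also have "\<dots> = limsup (\<lambda>n. ereal (average f n x))"
    using limsup_shift[of "\<lambda>n. ereal (average f n x)"] by simp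
  finally show ?thesis by (simp add: upper_average_def)
qed

text \<open>Apply \<open>maximal_ergodic\<close> to \<open>f\<close> minus its upper average plus
  \<open>e\<close>. As the upper average is invariant, the orbit sum of length \<open>n\<close> is
  \<open>n\<close> times \<open>average f n x - upper_average f x + e\<close>, which is positive for
  some \<open>n\<close> because averages come within \<open>e\<close> of their limsup infinitely
  often.\<close>

lemma integral_upper_average_le:
  assumes [measurable]: "f \<in> borel_measurable M"
  shows "(\<integral>x. upper_average f x \<partial>M) \<le> (\<integral>x. f x \<partial>M)"
proof (rule field_le_epsilon)
  fix e :: real assume e: "0 < e"
  have inv: "upper_average f ((T ^^ j) x) = upper_average f x" if "x \<in> space M" for x j
    using that by (induction j) (auto simp: upper_average_T funpow_space)
  have int: "integrable M f" "integrable M (upper_average f)"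
    using bd limsup_average(2) by (auto intro!: integrable_bounded_measurable[of _ C])
  have "0 \<le> (\<integral>x. f x - upper_average f x + e \<partial>M)"
  proof (rule maximal_ergodic)
    fix x assume x: "x \<in> space M"
    show "\<bar>f x - upper_average f x + e\<bar> \<le> 2 * C + e"
      using bd[OF x] limsup_average(2)[OF x] e by simp
    have "ereal (upper_average f x - e) < limsup (\<lambda>n. ereal (average f n x))"
      unfolding limsup_average(1)[OF x] using e by simp
    then have "\<exists>\<^sub>F n in sequentially. upper_average f x - e < average f n x"
      using Limsup_bounded[of "\<lambda>n. ereal (average f n x)" "ereal (upper_average f x - e)" sequentially]
      by (force simp: frequently_def not_less)
    then obtain n where n: "n > 0" "upper_average f x - e < average f n x"
      unfolding frequently_sequentially by (metis less_le_trans zero_less_one)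
    have "(\<Sum>j<n. f ((T ^^ j) x) - upper_average f ((T ^^ j) x) + e)
        = real n * (average f n x - upper_average f x + e)"
      using n x by (simp add: inv sum.distrib sum_subtractf average_def algebra_simps)
    also have "\<dots> > 0" using n by simp
    finally show "\<exists>n. 0 < (\<Sum>j<n. f ((T ^^ j) x) - upper_average f ((T ^^ j) x) + e)" by blast
  qed auto
  also have "\<dots> = (\<integral>x. f x \<partial>M) - (\<integral>x. upper_average f x \<partial>M) + e"
    using int by (simp add: prob_space)
  finally show "(\<integral>x. upper_average f x \<partial>M) \<le> (\<integral>x. f x \<partial>M) + e" by simp
qed

end

text \<open>Applying \<open>integral_upper_average_le\<close> to \<open>f\<close> and to its
  negative bounds the integral of limsup minus liminf by 0. That difference is nonnegative, so it
  vanishes almost everywhere, and both integral inequalities become equalities.\<close>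

theorem birkhoff_bounded:
  assumes [measurable]: "f \<in> borel_measurable M" and bd: "\<And>x. x \<in> space M \<Longrightarrow> \<bar>f x\<bar> \<le> C"
  shows "AE x in M. (\<lambda>n. average f n x) \<longlonglongrightarrow> upper_average f x"
    and "(\<integral>x. upper_average f x \<partial>M) = (\<integral>x. f x \<partial>M)"
proof -
  let ?g = "\<lambda>x. - f x"
  have bd': "\<bar>?g x\<bar> \<le> C" if "x \<in> space M" for x using bd that by simp
  have int: "integrable M (upper_average f)" "integrable M (upper_average ?g)"
    using limsup_average(2)[of f C, OF bd] limsup_average(2)[of ?g C, OF bd']
    by (auto intro!: integrable_bounded_measurable[of _ C])
  have avg: "average ?g n x = - average f n x" for n x
    by (simp add: average_def sum_negf)
  have lim: "liminf (\<lambda>n. ereal (average f n x)) = - ereal (upper_average ?g x)" if "x \<in> space M" for x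
    using limsup_average(1)[of ?g C, OF bd' that]
      ereal_Liminf_uminus[of sequentially "\<lambda>n. ereal (average ?g n x)"] by (simp add: avg)
  have nn: "0 \<le> upper_average f x + upper_average ?g x" if "x \<in> space M" for x
    using Liminf_le_Limsup[of sequentially "\<lambda>n. ereal (average f n x)"]
    unfolding lim[OF that] by (simp add: limsup_average(1)[of f C, OF bd that])
  have le: "(\<integral>x. upper_average f x + upper_average ?g x \<partial>M) \<le> 0"
    using integral_upper_average_le[of f C, OF bd] integral_upper_average_le[of ?g C, OF bd'] int
    by simp
  have "(\<integral>x. upper_average f x + upper_average ?g x \<partial>M) = 0"
    using le nn by (intro antisym integral_nonneg_AE) auto
  moreover have "integrable M (\<lambda>x. upper_average f x + upper_average ?g x)" using int by simp
  ultimately have ae: "AE x in M. upper_average f x + upper_average ?g x = 0"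
    using nn by (subst (asm) integral_nonneg_eq_0_iff_AE) auto
  show "AE x in M. (\<lambda>n. average f n x) \<longlonglongrightarrow> upper_average f x"
    using ae AE_space
  proof eventually_elim
    case (elim x)
    note True = elim(2)
    have "- upper_average ?g x = upper_average f x" using elim(1) by simp
    then have "liminf (\<lambda>n. ereal (average f n x)) = ereal (upper_average f x)"
        using lim[OF True] by simp
    then show ?case
      using limsup_average(1)[of f C, OF bd True]
      by (subst lim_ereal[symmetric]) (intro Liminf_eq_Limsup, auto)
  qed
  show "(\<integral>x. upper_average f x \<partial>M) = (\<integral>x. f x \<partial>M)"
    using integral_upper_average_le[of f C, OF bd] integral_upper_average_le[of ?g C, OF bd']
      \<open>(\<integral>x. upper_average f x + upper_average ?g x \<partial>M) = 0\<close> int by simp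
qed

text \<open>The maximal functions \<open>u N\<close> decrease to 0, hence so do their averages.\<close>

theorem birkhoff_varying:
  assumes h[measurable]: "\<And>n. h n \<in> borel_measurable M"
    and [measurable]: "g \<in> borel_measurable M"
    and bdh: "\<And>n x. x \<in> space M \<Longrightarrow> \<bar>h n x\<bar> \<le> C"
    and bdg: "\<And>x. x \<in> space M \<Longrightarrow> \<bar>g x\<bar> \<le> C"
    and lim: "AE x in M. (\<lambda>n. h n x) \<longlonglongrightarrow> g x"
  shows "AE x in M. (\<lambda>n. average (h n) n x) \<longlonglongrightarrow> upper_average g x"
proof -
  \<comment> \<open>The tail supremum bounds the errors of all \<open>h n\<close> with
    \<open>n \<ge> N\<close> at once, so \<open>N\<close> can be kept fixed while \<open>n\<close>
    grows.\<close>
  define u where "u N x = (SUP k\<in>{N..}. \<bar>h k x - g x\<bar>)" for N x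
  define W where "W x = limsup (\<lambda>n. ennreal \<bar>average (h n) n x - average g n x\<bar>)" for x
  have [measurable]: "W \<in> borel_measurable M" unfolding W_def by measurable
  have bda: "bdd_above ((\<lambda>k. \<bar>h k x - g x\<bar>) ` {N..})" if "x \<in> space M" for x N
    using bdh[OF that] bdg[OF that]
    by (intro bdd_aboveI2[of _ _ "C + C"] order_trans[OF abs_triangle_ineq4] add_mono) auto
  have [measurable]: "u N \<in> borel_measurable M" for N
    unfolding u_def using bda by (intro borel_measurable_cSUP) (auto intro: countable_subset)
  have ub: "\<bar>h k x - g x\<bar> \<le> u N x" if "x \<in> space M" "k \<ge> N" for x N k
    unfolding u_def using that bda by (intro cSUP_upper) auto
  have u_le: "u N x \<le> c" if "x \<in> space M" "\<And>k. k \<ge> N \<Longrightarrow> \<bar>h k x - g x\<bar> \<le> c" for x N c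
    unfolding u_def using that by (intro cSUP_least) auto
  have u0: "0 \<le> u N x" if "x \<in> space M" for x N
    using ub[OF that order_refl, of N] by linarith
  have uC: "\<bar>u N x\<bar> \<le> 2 * C" if "x \<in> space M" for x N
  proof -
    have "\<bar>h k x - g x\<bar> \<le> 2 * C" for k
      using bdh[OF that, of k] bdg[OF that] by linarith
    then show ?thesis using u_le[OF that, of N "2 * C"] u0[OF that, of N] by simp
  qed
  have "AE x in M. (\<lambda>N. u N x) \<longlonglongrightarrow> 0"
    using lim AE_space
  proof eventually_elim
    case (elim x)
    show ?case
    proof (rule LIMSEQ_I)
      fix e :: real assume "0 < e"
      then obtain N where N: "\<And>k. k \<ge> N \<Longrightarrow> \<bar>h k x - g x\<bar> < e / 2"
        using LIMSEQ_D[OF elim(1), of "e / 2"] by auto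
      have "\<bar>u n x\<bar> < e" if "n \<ge> N" for n
        using u_le[OF elim(2), of n "e/2"] N that u0[OF elim(2), of n] \<open>0 < e\<close>
        by (smt (verit, best) field_sum_of_halves order_trans)
      then show "\<exists>no. \<forall>n\<ge>no. norm (u n x - 0) < e" by auto
    qed
  qed
  then have "(\<lambda>N. \<integral>x. u N x \<partial>M) \<longlonglongrightarrow> (\<integral>x. 0 \<partial>M)"
    using uC by (intro integral_dominated_convergence[where w="\<lambda>_. 2 * C"]) auto
  then have u_int: "(\<lambda>N. ennreal (\<integral>x. u N x \<partial>M)) \<longlonglongrightarrow> 0"
    by (metis integral_zero tendsto_ennrealI ennreal_0)
  have "(\<integral>\<^sup>+x. W x \<partial>M) \<le> ennreal (\<integral>x. u N x \<partial>M)" for N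
  proof -
    have ua: "\<bar>upper_average (u N) x\<bar> \<le> 2 * C" if "x \<in> space M" for x
      using limsup_average(2)[of "u N" "2 * C", OF uC that] .
    have conv: "AE x in M. (\<lambda>n. average (u N) n x) \<longlonglongrightarrow> upper_average (u N) x"
      by (rule birkhoff_bounded(1)[of _ "2 * C"]) (use uC in auto)
    have nonneg: "AE x in M. 0 \<le> upper_average (u N) x"
      using conv AE_space
    proof eventually_elim
      case (elim x)
      show ?case
        by (rule LIMSEQ_le_const[OF elim(1)])
          (auto simp: average_def intro!: sum_nonneg divide_nonneg_nonneg u0 funpow_space elim)
    qed
    have "(\<integral>\<^sup>+x. W x \<partial>M) \<le> (\<integral>\<^sup>+x. ennreal (upper_average (u N) x) \<partial>M)"
    proof (rule nn_integral_mono_AE)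
      show "AE x in M. W x \<le> ennreal (upper_average (u N) x)"
        using conv AE_space
      proof eventually_elim
        case (elim x)
        have "\<bar>average (h n) n x - average g n x\<bar> \<le> average (u N) n x" if "n \<ge> N" for n
        proof -
          have "\<bar>\<Sum>j<n. h n ((T ^^ j) x) - g ((T ^^ j) x)\<bar> \<le> (\<Sum>j<n. u N ((T ^^ j) x))"
            using that elim(2) by (intro order_trans[OF sum_abs] sum_mono ub funpow_space)
          then show ?thesis
            by (simp add: average_def sum_subtractf divide_right_mono flip: diff_divide_distrib)
        qed
        then have "W x \<le> limsup (\<lambda>n. ennreal (average (u N) n x))"
          unfolding W_def
          by (intro Limsup_mono) (auto simp: eventually_sequentially intro!: exI[of _ N] ennreal_leI)
        also have "\<dots> = ennreal (upper_average (u N) x)"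
          by (intro lim_imp_Limsup tendsto_ennrealI elim) auto
        finally show ?case .
      qed
    qed
    also have "\<dots> = ennreal (\<integral>x. upper_average (u N) x \<partial>M)"
      using nonneg ua by (intro nn_integral_eq_integral integrable_bounded_measurable[of _ "2 * C"]) auto
    \<comment> \<open>Averaging preserves the integral, so the integral of \<open>W\<close> is
      bounded by that of \<open>u N\<close>, which tends to 0.\<close>
    also have "(\<integral>x. upper_average (u N) x \<partial>M) = (\<integral>x. u N x \<partial>M)"
      by (rule birkhoff_bounded(2)[of _ "2 * C"]) (use uC in auto)
    finally show ?thesis .
  qed
  then have "(\<integral>\<^sup>+x. W x \<partial>M) \<le> 0"
    by (intro LIMSEQ_le_const[OF u_int]) auto
  then have "AE x in M. W x = 0"
    by (subst nn_integral_0_iff_AE[symmetric]) auto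
  moreover have "AE x in M. (\<lambda>n. average g n x) \<longlonglongrightarrow> upper_average g x"
    by (rule birkhoff_bounded(1)[of _ C]) (use bdg in auto)
  ultimately show ?thesis
  proof eventually_elim
    case (elim x)
    have "(\<lambda>n. ennreal \<bar>average (h n) n x - average g n x\<bar>) \<longlonglongrightarrow> 0"
      using elim(1) Liminf_le_Limsup[of sequentially "\<lambda>n. ennreal \<bar>average (h n) n x - average g n x\<bar>"]
      unfolding W_def by (intro Liminf_eq_Limsup) auto
    then have "(\<lambda>n. \<bar>average (h n) n x - average g n x\<bar>) \<longlonglongrightarrow> 0"
      by (subst (asm) tendsto_ennreal_iff[where x=0, simplified]) auto
    then have "(\<lambda>n. average (h n) n x - average g n x) \<longlonglongrightarrow> 0"
      by (rule tendsto_rabs_zero_cancel)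
    from tendsto_add[OF this elim(2)] show ?case by simp
  qed
qed

end

section \<open>Stationary point sets with bounded local counts\<close>

text \<open>Separating growing directions from unit ones lets a box be enlarged one direction at a
  time. Half-open sides let integer translates tile without overlap; for \<open>I = {}\<close> the
  value of \<open>n\<close> is immaterial.\<close>

definition slab :: "'d set \<Rightarrow> nat \<Rightarrow> (real^'d) set" where
  "slab I n = {y. \<forall>i. if i \<in> I then - real n \<le> y $ i \<and> y $ i < real n else 0 \<le> y $ i \<and> y $ i < 1}"

lemma slab_bounded: "bounded (slab I n)"
proof (rule bounded_subset[OF bounded_cbox], rule subsetI)
  fix y assume y: "y \<in> slab I n"
  have "- real n - 1 \<le> y $ i \<and> y $ i \<le> real n + 1" for i
    using y unfolding slab_def by (cases "i \<in> I") (auto dest!: spec[of _ i])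
  then show "y \<in> cbox (\<chi> i. - real n - 1) (\<chi> i. real n + 1)"
    by (simp add: mem_box_cart)
qed

lemma slab_borel: "slab I n \<in> sets borel"
  unfolding slab_def by measurable

lemma slab_insert:
  assumes "k \<notin> I"
  shows "slab (insert k I) n = (\<Union>j\<in>{- int n..<int n}. (+) (real_of_int j *\<^sub>R axis k 1) ` slab I n)"
    (is "?L = ?R")
proof (intro equalityI subsetI)
  fix y assume y: "y \<in> ?L"
  \<comment> \<open>The unit layer containing \<open>y\<close> is indexed by the integer part of its
    \<open>k\<close>-th coordinate.\<close>
  define j where "j = \<lfloor>y $ k\<rfloor>"
  have yk: "- real n \<le> y $ k" "y $ k < real n" using y by (auto simp: slab_def)
  then have j: "j \<in> {- int n..<int n}"
    unfolding j_def by (auto simp: le_floor_iff floor_less_iff)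
  have "y - real_of_int j *\<^sub>R axis k 1 \<in> slab I n"
  proof (unfold slab_def, intro CollectI allI)
    fix i
    have "real_of_int j \<le> y $ k" "y $ k < real_of_int j + 1" unfolding j_def by linarith+
    then show "if i \<in> I then - real n \<le> (y - real_of_int j *\<^sub>R axis k 1) $ i \<and>
        (y - real_of_int j *\<^sub>R axis k 1) $ i < real n
      else 0 \<le> (y - real_of_int j *\<^sub>R axis k 1) $ i \<and> (y - real_of_int j *\<^sub>R axis k 1) $ i < 1"
      using y assms unfolding slab_def by (cases "i = k") (auto simp: axis_def dest!: spec[of _ i])
  qed
  then have "y \<in> (+) (real_of_int j *\<^sub>R axis k 1) ` slab I n"
    by (intro image_eqI[of _ _ "y - real_of_int j *\<^sub>R axis k 1"]) auto
  then show "y \<in> ?R" using j by blast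
next
  fix y assume "y \<in> ?R"
  then obtain j z where j: "- int n \<le> j" "j < int n" and z: "z \<in> slab I n"
    and y: "y = real_of_int j *\<^sub>R axis k 1 + z" by auto
  have "0 \<le> z $ k" "z $ k < 1" using z assms by (auto simp: slab_def split: if_splits)
  moreover have "- real n \<le> real_of_int j" "real_of_int j \<le> real n - 1" using j by linarith+
  ultimately have "- real n \<le> y $ k \<and> y $ k < real n" unfolding y by (simp add: axis_def)
  moreover have "y $ i = z $ i" if "i \<noteq> k" for i using that unfolding y by (simp add: axis_def)
  ultimately have "if i \<in> insert k I then - real n \<le> y $ i \<and> y $ i < real n else 0 \<le> y $ i \<and> y $ i < 1" for i
    using z unfolding slab_def by (cases "i = k") auto
  then show "y \<in> ?L" unfolding slab_def by (intro CollectI allI)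
qed

text \<open>The bound in \<open>count_bounded\<close> is uniform over configurations: it makes local
  counts bounded functions, to which the ergodic theorems above apply, and makes the intensity
  finite on bounded sets.\<close>

locale stationary_point_set = prob_space M for M :: "'a measure" +
  fixes T :: "real^'d \<Rightarrow> 'a \<Rightarrow> 'a" and S :: "'a \<Rightarrow> (real^'d) set"
  assumes T_meas [measurable]: "\<And>t. T t \<in> measurable M M"
    and distr_T: "\<And>t. distr M M (T t) = M"
    and S_T: "\<And>t x. x \<in> space M \<Longrightarrow> S (T t x) = (+) t ` S x"
    and count_bounded:
      "\<And>A. bounded A \<Longrightarrow> \<exists>K::nat. \<forall>x\<in>space M. finite (S x \<inter> A) \<and> card (S x \<inter> A) \<le> K"
    and count_measurable:
      "\<And>A. bounded A \<Longrightarrow> A \<in> sets borel \<Longrightarrow> (\<lambda>x. real (card (S x \<inter> A))) \<in> borel_measurable M"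
begin

definition N :: "(real^'d) set \<Rightarrow> 'a \<Rightarrow> real" where
  "N A x = real (card (S x \<inter> A))"

lemma N_measurable: "bounded A \<Longrightarrow> A \<in> sets borel \<Longrightarrow> N A \<in> borel_measurable M"
  unfolding N_def[abs_def] by (rule count_measurable)

lemma N_nonneg: "0 \<le> N A x"
  by (simp add: N_def)

lemma finite_S: "bounded A \<Longrightarrow> x \<in> space M \<Longrightarrow> finite (S x \<inter> A)"
  using count_bounded by blast

lemma N_mono: "A \<subseteq> B \<Longrightarrow> bounded B \<Longrightarrow> x \<in> space M \<Longrightarrow> N A x \<le> N B x"
  unfolding N_def of_nat_le_iff by (intro card_mono finite_S) auto

lemma T_space: "x \<in> space M \<Longrightarrow> T t x \<in> space M"
  using T_meas by (rule measurable_space)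

lemma N_T:
  assumes "x \<in> space M" shows "N ((+) t ` A) (T t x) = N A x"
proof -
  have "(+) t ` S x \<inter> (+) t ` A = (+) t ` (S x \<inter> A)" by auto
  then show ?thesis by (simp add: N_def S_T[OF assms] card_image)
qed

lemma N_T':
  assumes "x \<in> space M" shows "N A (T t x) = N ((+) (- t) ` A) x"
proof -
  have "(+) t ` (+) (- t) ` A = A" by (auto simp: image_image)
  then show ?thesis using N_T[OF assms, of t "(+) (- t) ` A"] by simp
qed

lemma N_T_power:
  assumes "x \<in> space M" shows "N A ((T t ^^ j) x) = N ((+) (- (real j *\<^sub>R t)) ` A) x"
proof (induction j arbitrary: A)
  case (Suc j)
  have x: "(T t ^^ j) x \<in> space M" using assms by (induction j) (auto intro: T_space)
  show ?case by (simp add: N_T'[OF x] Suc image_image algebra_simps)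
qed simp

lemma N_UN:
  assumes "finite J" "\<And>j. j \<in> J \<Longrightarrow> bounded (A j)" "disjoint_family_on A J" "x \<in> space M"
  shows "N (\<Union>j\<in>J. A j) x = (\<Sum>j\<in>J. N (A j) x)"
proof -
  have "card (\<Union>j\<in>J. S x \<inter> A j) = (\<Sum>j\<in>J. card (S x \<inter> A j))"
    using assms by (intro card_UN_disjoint) (auto simp: finite_S disjoint_family_on_def)
  moreover have "S x \<inter> (\<Union>j\<in>J. A j) = (\<Union>j\<in>J. S x \<inter> A j)" by auto
  ultimately show ?thesis unfolding N_def by (simp only: of_nat_sum)
qed

section \<open>Counts in boxes growing in several directions\<close>

lemma measure_preserving_T: "measure_preserving_map M (T t)"
  by unfold_locales (auto simp: distr_T)

text \<open>Layers are counted by moving the configuration instead of the box. Layers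
  \<open>0\<close> to \<open>n - 1\<close> are met along the orbit of the shift by
  \<open>- axis k 1\<close>, layers \<open>-1\<close> to \<open>-n\<close> along that of the
  opposite shift, whose extra application of \<open>T\<close> keeps layer \<open>0\<close> from
  being counted twice.\<close>

lemma N_slab_insert:
  assumes k: "k \<notin> I" and x: "x \<in> space M"
  shows "N (slab (insert k I) n) x =
      (\<Sum>j<n. N (slab I n) ((T (- axis k 1) ^^ j) x))
    + (\<Sum>j<n. N (slab I n) (T (axis k 1) ((T (axis k 1) ^^ j) x)))"
proof -
  let ?A = "\<lambda>j::int. (+) (real_of_int j *\<^sub>R axis k 1) ` slab I n"
  have disj: "disjoint_family_on ?A {- int n..<int n}"
  proof (clarsimp simp: disjoint_family_on_def, rule equals0I, clarsimp)
    fix i j :: int and y z assume ij: "i \<noteq> j" "y \<in> slab I n" "z \<in> slab I n"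
      and eq: "real_of_int i *\<^sub>R axis k 1 + y = real_of_int j *\<^sub>R axis k 1 + z"
    have "real_of_int i + y $ k = real_of_int j + z $ k"
      using arg_cong[OF eq, of "\<lambda>v. v $ k"] by (simp add: axis_def)
    moreover have "0 \<le> y $ k" "y $ k < 1" "0 \<le> z $ k" "z $ k < 1"
      using ij k by (auto simp: slab_def split: if_splits)
    ultimately show False using ij(1) by linarith
  qed
  have "N (slab (insert k I) n) x = (\<Sum>j\<in>{- int n..<int n}. N (?A j) x)"
    unfolding slab_insert[OF k] using disj x
    by (intro N_UN) (auto intro: bounded_translation slab_bounded)
  also have "{- int n..<int n} = int ` {..<n} \<union> (\<lambda>j. - int (Suc j)) ` {..<n}"
  proof (intro equalityI subsetI)
    fix j assume j: "j \<in> {- int n..<int n}"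
    show "j \<in> int ` {..<n} \<union> (\<lambda>j. - int (Suc j)) ` {..<n}"
    proof (cases "0 \<le> j")
      case True then show ?thesis using j by (intro UnI1 image_eqI[of _ _ "nat j"]) auto
    next
      case False then show ?thesis using j by (intro UnI2 image_eqI[of _ _ "nat (- j - 1)"]) auto
    qed
  qed auto
  also have "(\<Sum>j\<in>\<dots>. N (?A j) x) = (\<Sum>j\<in>int ` {..<n}. N (?A j) x) + (\<Sum>j\<in>(\<lambda>j. - int (Suc j)) ` {..<n}. N (?A j) x)"
    by (intro sum.union_disjoint) auto
  also have "(\<Sum>j\<in>int ` {..<n}. N (?A j) x) = (\<Sum>j<n. N (slab I n) ((T (- axis k 1) ^^ j) x))"
    by (subst sum.reindex) (auto simp: N_T_power[OF x])
  also have "(\<Sum>j\<in>(\<lambda>j. - int (Suc j)) ` {..<n}. N (?A j) x)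
      = (\<Sum>j<n. N (slab I n) (T (axis k 1) ((T (axis k 1) ^^ j) x)))"
  proof (subst sum.reindex, safe intro!: sum.cong)
    fix j
    have "N (slab I n) (T (axis k 1) ((T (axis k 1) ^^ j) x)) = N (slab I n) ((T (axis k 1) ^^ Suc j) x)"
      by simp
    then show "((\<lambda>j. N (?A j) x) \<circ> (\<lambda>j. - int (Suc j))) j =
         N (slab I n) (T (axis k 1) ((T (axis k 1) ^^ j) x))"
      unfolding N_T_power[OF x] by (simp only: o_def of_int_minus of_int_of_nat_eq scaleR_minus_left)
  qed (auto simp: inj_on_def)
  finally show ?thesis .
qed

text \<open>Beyond convergence, the induction carries a bound \<open>K\<close> common to the counts
  and the limit, required by the next Birkhoff step, and the integral of the limit, which later
  identifies the constant. As a product, the bound can be summed over the layers of the next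
  direction.\<close>

lemma slab_averages:
  assumes "finite I"
  shows "\<exists>g K. g \<in> borel_measurable M \<and> (\<forall>x\<in>space M. \<bar>g x\<bar> \<le> K)
    \<and> (\<forall>n. \<forall>x\<in>space M. N (slab I n) x \<le> K * (2 * real n) ^ card I)
    \<and> (AE x in M. (\<lambda>n. N (slab I n) x / (2 * real n) ^ card I) \<longlonglongrightarrow> g x)
    \<and> (\<integral>x. g x \<partial>M) = (\<integral>x. N (slab {} 0) x \<partial>M)"
  using assms
proof (induction I)
  case empty
  obtain A where A: "A = (slab {} 0 :: (real^'d) set)" by blast
  have eq: "slab {} n = A" for n by (simp add: slab_def A)
  obtain K :: nat where "\<forall>x\<in>space M. card (S x \<inter> slab {} 0) \<le> K"
    using count_bounded[OF slab_bounded, of "{}" 0] by blast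
  then have "\<forall>x\<in>space M. N A x \<le> real K" by (simp add: N_def A)
  moreover have "N A \<in> borel_measurable M"
    unfolding A by (intro N_measurable slab_bounded slab_borel)
  ultimately show ?case
    by (intro exI[of _ "N A"] exI[of _ "real K"]) (auto simp: eq N_nonneg)
next
  case (insert k I)
  from insert.IH obtain g K where g[measurable]: "g \<in> borel_measurable M"
    and gK0: "\<forall>x\<in>space M. \<bar>g x\<bar> \<le> K"
    and NK0: "\<forall>n. \<forall>x\<in>space M. N (slab I n) x \<le> K * (2 * real n) ^ card I"
    and lim: "AE x in M. (\<lambda>n. N (slab I n) x / (2 * real n) ^ card I) \<longlonglongrightarrow> g x"
    and int: "(\<integral>x. g x \<partial>M) = (\<integral>x. N (slab {} 0) x \<partial>M)"
    by (elim exE conjE)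
  note gK = gK0[rule_format] and NK = NK0[rule_format]
  let ?e = "axis k (1::real) :: real^'d"
  interpret P: measure_preserving_map M "T (- ?e)" by (rule measure_preserving_T)
  interpret Q: measure_preserving_map M "T ?e" by (rule measure_preserving_T)
  define h where "h n x = N (slab I n) x / (2 * real n) ^ card I" for n x
  have h[measurable]: "h n \<in> borel_measurable M" for n
    unfolding h_def using N_measurable[OF slab_bounded slab_borel, of I n] by measurable
  have K0: "0 \<le> K" using gK not_empty by (meson abs_ge_zero ex_in_conv order_trans)
  have hK: "\<bar>h n x\<bar> \<le> K" if "x \<in> space M" for n x
  proof -
    define c where "c = (2 * real n) ^ card I"
    have "0 \<le> c" by (simp add: c_def)
    moreover have "N (slab I n) x \<le> K * c" unfolding c_def by (rule NK[OF that])
    ultimately show ?thesis using K0 N_nonneg[of "slab I n" x]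
      unfolding h_def c_def[symmetric] by (cases "c = 0") (auto simp: divide_le_eq)
  qed
  let ?g' = "\<lambda>x. g (T ?e x)" and ?h' = "\<lambda>n x. h n (T ?e x)"
  \<comment> \<open>Each orientation supplies \<open>n\<close> of the \<open>2 * n\<close> layers,
    hence the weight one half.\<close>
  define G where "G x = (P.upper_average g x + Q.upper_average ?g' x) / 2" for x
  have limP: "AE x in M. (\<lambda>n. P.average (h n) n x) \<longlonglongrightarrow> P.upper_average g x"
    by (rule P.birkhoff_varying[where C=K]) (use hK gK lim in \<open>auto simp: h_def\<close>)
  \<comment> \<open>Almost sure convergence passes to the shifted functions because \<open>T\<close>
    preserves the measure.\<close>
  have lim': "AE x in M. (\<lambda>n. ?h' n x) \<longlonglongrightarrow> ?g' x"
    by (rule AE_distrD[OF T_meas[of ?e]]) (unfold distr_T h_def, rule lim)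
  have limQ: "AE x in M. (\<lambda>n. Q.average (?h' n) n x) \<longlonglongrightarrow> Q.upper_average ?g' x"
    by (rule Q.birkhoff_varying[where C=K]) (use hK gK lim' T_space in auto)
  have [measurable]: "G \<in> borel_measurable M" unfolding G_def by measurable
  have bd: "\<bar>P.upper_average g x\<bar> \<le> K" "\<bar>Q.upper_average ?g' x\<bar> \<le> K" if "x \<in> space M" for x
    using P.limsup_average(2)[of g K, OF gK that] Q.limsup_average(2)[of ?g' K, OF gK[OF T_space] that] by auto
  have GK: "\<bar>G x\<bar> \<le> K" if "x \<in> space M" for x
    using bd[OF that] unfolding G_def by (auto simp: abs_le_iff field_simps)
  have split: "N (slab (insert k I) n) x / (2 * real n) ^ card (insert k I)
      = (P.average (h n) n x + Q.average (?h' n) n x) / 2" if "x \<in> space M" for n x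
  proof -
    have eq: "(a + b) / (2 * real n * c) = (a / c / real n + b / c / real n) / 2" for a b c
      by (simp add: add_divide_distrib mult_ac)
    show ?thesis
      unfolding N_slab_insert[OF insert(2) that] P.average_def Q.average_def h_def
        sum_divide_distrib[symmetric] card_insert_disjoint[OF insert(1,2)] power_Suc
      by (rule eq)
  qed
  have bdN: "N (slab (insert k I) n) x \<le> K * (2 * real n) ^ card (insert k I)" if x: "x \<in> space M" for n x
  proof -
    have "N (slab (insert k I) n) x \<le> (\<Sum>j<n. K * (2 * real n) ^ card I) + (\<Sum>j<n. K * (2 * real n) ^ card I)"
      unfolding N_slab_insert[OF insert(2) x]
      by (intro add_mono sum_mono NK T_space P.funpow_space Q.funpow_space x)
    then show ?thesis using insert(1,2) by (simp add: algebra_simps)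
  qed
  have lim_G: "AE x in M. (\<lambda>n. N (slab (insert k I) n) x / (2 * real n) ^ card (insert k I)) \<longlonglongrightarrow> G x"
    using limP limQ AE_space
  proof eventually_elim
    case (elim x)
    show ?case unfolding split[OF elim(3)] G_def
      by (intro tendsto_intros elim) auto
  qed
  have int_G: "(\<integral>x. G x \<partial>M) = (\<integral>x. N (slab {} 0) x \<partial>M)"
  proof -
    have "integrable M (P.upper_average g)" "integrable M (Q.upper_average ?g')"
      using bd by (auto intro!: integrable_bounded_measurable[of _ K])
    then have "(\<integral>x. G x \<partial>M) = ((\<integral>x. P.upper_average g x \<partial>M) + (\<integral>x. Q.upper_average ?g' x \<partial>M)) / 2"
      unfolding G_def by simp
    also have "(\<integral>x. P.upper_average g x \<partial>M) = (\<integral>x. g x \<partial>M)"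
      by (rule P.birkhoff_bounded(2)[of _ K]) (use gK in auto)
    also have "(\<integral>x. Q.upper_average ?g' x \<partial>M) = (\<integral>x. ?g' x \<partial>M)"
      by (rule Q.birkhoff_bounded(2)[of _ K]) (use gK T_space in auto)
    also have "(\<integral>x. ?g' x \<partial>M) = (\<integral>x. g x \<partial>M)" by (rule Q.integral_comp_T) simp
    finally show ?thesis using int by simp
  qed
  show ?case
  proof (intro exI conjI ballI allI)
    show "G \<in> borel_measurable M" by measurable
  qed (fact GK bdN lim_G int_G)+
qed

end

text \<open>A sublevel set strictly below the expectation cannot have probability 1, so it is null.
  Hence \<open>g\<close> is almost surely at least its expectation, and
  \<open>g - expectation g\<close>, nonnegative with integral zero, vanishes.\<close>

lemma (in prob_space) AE_eq_expectation_if_trivial_sublevels: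
  fixes g :: "'a \<Rightarrow> real"
  assumes g[measurable]: "g \<in> borel_measurable M" "integrable M g"
    and triv: "\<And>c. prob {x \<in> space M. g x \<le> c} = 0 \<or> prob {x \<in> space M. g x \<le> c} = 1"
  shows "AE x in M. g x = expectation g"
proof -
  have "AE x in M. expectation g - 1 / real (Suc n) < g x" for n
  proof -
    let ?c = "expectation g - 1 / real (Suc n)"
    let ?D = "{x \<in> space M. g x \<le> ?c}"
    have "prob ?D \<noteq> 1"
    proof
      assume "prob ?D = 1"
      then have "AE x in M. g x \<le> ?c" by (subst (asm) prob_eq_1) auto
      then have "expectation g \<le> expectation (\<lambda>_. ?c)" using g by (intro integral_mono_AE) auto
      then show False by (simp add: prob_space)
    qed
    then have "prob ?D = 0" using triv by blast
    then have "AE x in M. x \<notin> ?D" by (subst (asm) prob_eq_0) auto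
    then show ?thesis using AE_space by eventually_elim auto
  qed
  then have "AE x in M. \<forall>n. expectation g - 1 / real (Suc n) < g x"
    by (simp add: AE_all_countable)
  then have ge: "AE x in M. 0 \<le> g x - expectation g"
  proof eventually_elim
    case (elim x)
    have "(\<lambda>n. expectation g - 1 / real (Suc n)) \<longlonglongrightarrow> expectation g"
      using tendsto_diff[OF tendsto_const LIMSEQ_Suc[OF lim_1_over_n]] by simp
    then have "expectation g \<le> g x"
      using elim by (intro LIMSEQ_le_const2[of _ _ "g x"]) (auto intro: less_imp_le)
    then show ?case by simp
  qed
  have "AE x in M. g x - expectation g = 0"
    using ge by (subst integral_nonneg_eq_0_iff_AE[symmetric]) (auto simp: g prob_space)
  then show ?thesis by eventually_elim simp
qed

text \<open>Passes from integer half-sides to real edge lengths: as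
  \<open>2 * real (\<phi> R)\<close> stays within \<open>q\<close> of \<open>R\<close>, their ratio
  tends to 1, and the two normalisations are equivalent.\<close>

lemma density_along_scales:
  fixes a :: "nat \<Rightarrow> real" and c q :: real and \<phi> :: "real \<Rightarrow> nat"
  assumes lim: "(\<lambda>n. a n / (2 * real n) ^ d) \<longlonglongrightarrow> c"
    and \<phi>: "\<forall>\<^sub>F R in at_top. \<bar>2 * real (\<phi> R) - R\<bar> \<le> q"
  shows "((\<lambda>R. a (\<phi> R) / R ^ d) \<longlongrightarrow> c) at_top"
proof -
  have lower: "\<forall>\<^sub>F R in at_top. (R - q) / 2 \<le> real (\<phi> R)"
    using \<phi> by eventually_elim (auto simp: abs_le_iff)
  have "filterlim (\<lambda>R. (R - q) / 2) at_top at_top" by real_asymp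
  then have "filterlim (\<lambda>R. real (\<phi> R)) at_top at_top"
    using lower by (rule filterlim_at_top_mono)
  then have top: "filterlim \<phi> sequentially at_top"
    by (simp add: filterlim_sequentially_iff_filterlim_real)
  have ratio: "((\<lambda>R. 2 * real (\<phi> R) / R) \<longlongrightarrow> 1) at_top"
  proof (rule tendsto_sandwich[where f="\<lambda>R. (R - q) / R" and h="\<lambda>R. (R + q) / R"])
    show "\<forall>\<^sub>F R in at_top. (R - q) / R \<le> 2 * real (\<phi> R) / R"
      using \<phi> eventually_gt_at_top[of 0] by eventually_elim (auto simp: abs_le_iff divide_right_mono)
    show "\<forall>\<^sub>F R in at_top. 2 * real (\<phi> R) / R \<le> (R + q) / R"
      using \<phi> eventually_gt_at_top[of 0] by eventually_elim (auto simp: abs_le_iff divide_right_mono)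
  qed real_asymp+
  have "((\<lambda>R. a (\<phi> R) / (2 * real (\<phi> R)) ^ d * (2 * real (\<phi> R) / R) ^ d) \<longlongrightarrow> c * 1 ^ d) at_top"
    by (intro tendsto_mult tendsto_power ratio filterlim_compose[OF lim top])
  moreover have "\<forall>\<^sub>F R in at_top. a (\<phi> R) / (2 * real (\<phi> R)) ^ d * (2 * real (\<phi> R) / R) ^ d = a (\<phi> R) / R ^ d"
    using eventually_gt_at_top[of 0] eventually_compose_filterlim[OF eventually_gt_at_top[of 0] top]
  proof eventually_elim
    case (elim R)
    then have "(2 * real (\<phi> R)) ^ d \<noteq> 0" by simp
    then show ?case by (simp add: power_divide)
  qed
  ultimately show ?thesis by (simp add: tendsto_cong)
qed

lemma translate_slab_UNIV:
  fixes t :: "real^'d"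
  assumes "\<And>i. \<bar>t $ i\<bar> \<le> real p"
  shows "(+) t ` slab UNIV n \<subseteq> slab UNIV (n + p)"
proof clarify
  fix y :: "real^'d" assume y: "y \<in> slab UNIV n"
  have "- real (n + p) \<le> (t + y) $ i \<and> (t + y) $ i < real (n + p)" for i
  proof -
    have "- real n \<le> y $ i" "y $ i < real n" using y by (auto simp: slab_def)
    then show ?thesis using assms[of i] by (auto simp: abs_le_iff)
  qed
  then show "t + y \<in> slab UNIV (n + p)" by (simp add: slab_def)
qed

lemma emeasure_lborel_unit_slab: "emeasure lborel (slab {} 0 :: (real^'d) set) = 1"
proof (rule antisym)
  let ?Q = "slab {} 0 :: (real^'d) set"
  let ?o = "\<chi> i. 1 :: real^'d"
  have one: "?o \<bullet> b = 1" if "b \<in> Basis" for b :: "real^'d"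
    using that by (auto simp: Basis_vec_def inner_axis)
  have "emeasure lborel (?Q) \<le> emeasure lborel (cbox 0 ?o)"
    by (intro emeasure_mono) (auto simp: slab_def mem_box_cart less_imp_le)
  also have "\<dots> = 1" using one by (simp add: emeasure_lborel_cbox)
  finally show "emeasure lborel (?Q) \<le> 1" .
  have "1 = emeasure lborel (box 0 ?o)" using one by (simp add: emeasure_lborel_box)
  also have "\<dots> \<le> emeasure lborel (?Q)"
    using slab_borel by (intro emeasure_mono) (auto simp: slab_def mem_box_cart intro: less_imp_le)
  finally show "1 \<le> emeasure lborel (?Q)" .
qed

section \<open>Upper density of the counts in growing boxes\<close>

context stationary_point_set
begin

text \<open>A version of the limit in \<open>slab_averages\<close> defined at every configuration.
  That limit is fixed only up to null sets and built from axis shifts, while ergodicity concerns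
  sets that are exactly invariant under all translations.\<close>

definition upper_density :: "'a \<Rightarrow> ereal" where
  "upper_density x = limsup (\<lambda>n. ereal (N (slab UNIV n) x / (2 * real n) ^ CARD('d)))"

lemma upper_density_measurable [measurable]: "upper_density \<in> borel_measurable M"
proof -
  have [measurable]: "N (slab UNIV n) \<in> borel_measurable M" for n
    by (intro N_measurable slab_bounded slab_borel)
  show ?thesis unfolding upper_density_def[abs_def] by measurable
qed

text \<open>Enlarging the half-side by a fixed \<open>p\<close> multiplies the volume by a factor
  tending to 1. Since the normalised counts of \<open>x\<close> are bounded, the resulting error
  vanishes in the limit.\<close>

lemma upper_density_le:
  assumes x: "x \<in> space M" and le: "\<And>n. N (slab UNIV n) y \<le> N (slab UNIV (n + p)) x"
  shows "upper_density y \<le> upper_density x"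
proof -
  define a where "a n x = N (slab UNIV n) x / (2 * real n) ^ CARD('d)" for n x
  define r where "r n = ((real n + real p) / real n) ^ CARD('d)" for n
  obtain K where K: "\<And>n x. x \<in> space M \<Longrightarrow> N (slab UNIV n) x \<le> K * (2 * real n) ^ CARD('d)"
    using slab_averages[of UNIV] by auto
  have aK: "a (n + p) x * (r n - 1) \<le> K * (r n - 1)" if "n > 0" for n
  proof (rule mult_right_mono)
    show "a (n + p) x \<le> K"
      using K[OF x, of "n + p"] that by (simp add: a_def divide_le_eq)
    show "0 \<le> r n - 1" using that by (simp add: r_def)
  qed
  have "a n y \<le> K * (r n - 1) + a (n + p) x" if "n > 0" for n
  proof -
    have "a n y \<le> N (slab UNIV (n + p)) x / (2 * real n) ^ CARD('d)"
      unfolding a_def by (intro divide_right_mono le) auto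
    also have "\<dots> = a (n + p) x * r n"
    proof -
      have "c / (2 * u) ^ k = c / (2 * v) ^ k * (v / u) ^ k" if "u > 0" "v > 0" for c u v :: real and k
        using that by (simp add: power_divide power_mult_distrib)
      from this[of "real n" "real (n + p)"] show ?thesis
        using that unfolding a_def r_def by simp
    qed
    finally show ?thesis using aK[OF that] by (simp add: algebra_simps)
  qed
  then have "upper_density y \<le> limsup (\<lambda>n. ereal (K * (r n - 1)) + ereal (a (n + p) x))"
    unfolding upper_density_def a_def[symmetric]
    by (intro Limsup_mono) (auto simp: eventually_sequentially intro!: exI[of _ 1])
  also have "\<dots> = 0 + limsup (\<lambda>n. ereal (a (n + p) x))"
  proof (rule ereal_limsup_lim_add)
    have "(\<lambda>n. (real n + real p) / real n) \<longlonglongrightarrow> 1" by real_asymp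
    then have "(\<lambda>n. K * (r n - 1)) \<longlonglongrightarrow> K * (1 ^ CARD('d) - 1)"
      unfolding r_def by (intro tendsto_intros)
    then show "(\<lambda>n. ereal (K * (r n - 1))) \<longlonglongrightarrow> 0" by (simp add: zero_ereal_def)
  qed auto
  also have "\<dots> = upper_density x"
    unfolding upper_density_def a_def[symmetric] using limsup_shift_k[of "\<lambda>n. ereal (a n x)" p] by simp
  finally show ?thesis .
qed

lemma upper_density_T:
  assumes x: "x \<in> space M"
  shows "upper_density (T t x) = upper_density x"
proof -
  define p where "p = nat \<lceil>norm t\<rceil>"
  have "norm t \<le> real p" unfolding p_def by linarith
  then have p: "\<bar>t $ i\<bar> \<le> real p" for i
    using component_le_norm_cart[of t i] by linarith
  have "N (slab UNIV n) (T t x) \<le> N (slab UNIV (n + p)) x" for n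
    unfolding N_T'[OF x] using p
    by (intro N_mono translate_slab_UNIV slab_bounded x) auto
  moreover have "N (slab UNIV n) x \<le> N (slab UNIV (n + p)) (T t x)" for n
    unfolding N_T[OF x, of t "slab UNIV n", symmetric] using p
    by (intro N_mono translate_slab_UNIV slab_bounded T_space x) auto
  ultimately show ?thesis
    using upper_density_le[OF x, of "T t x" p] upper_density_le[OF T_space[OF x], of x p t] by auto
qed

text \<open>Unlike \<open>N\<close>, whose \<open>card\<close> is \<open>0\<close> on infinite sets,
  this counts correctly in unbounded sets, as countable additivity of the intensity
  requires.\<close>

definition number :: "(real^'d) set \<Rightarrow> 'a \<Rightarrow> ennreal" where
  "number A x = emeasure (count_space UNIV) (S x \<inter> A)"

lemma number_eq_N: "bounded A \<Longrightarrow> x \<in> space M \<Longrightarrow> number A x = ennreal (N A x)"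
  by (simp add: number_def N_def emeasure_count_space_finite finite_S ennreal_of_nat_eq_real_of_nat)

lemma number_measurable [measurable]:
  assumes A[measurable]: "A \<in> sets borel"
  shows "number A \<in> borel_measurable M"
proof -
  \<comment> \<open>Unbounded sets are exhausted by balls, since \<open>count_measurable\<close>
    concerns bounded sets.\<close>
  have "number A = (\<lambda>x. SUP n. number (A \<inter> cball 0 (real n)) x)"
  proof
    fix x
    have "(SUP n. emeasure (count_space UNIV) (S x \<inter> (A \<inter> cball 0 (real n))))
        = emeasure (count_space UNIV) (\<Union>n. S x \<inter> (A \<inter> cball 0 (real n)))"
      by (intro SUP_emeasure_incseq) (auto simp: incseq_def)
    also have "(\<Union>n. S x \<inter> (A \<inter> cball 0 (real n))) = S x \<inter> A"
      by (auto intro: real_arch_simple)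
    finally show "number A x = (SUP n. number (A \<inter> cball 0 (real n)) x)" by (simp add: number_def)
  qed
  moreover have [measurable]: "number (A \<inter> cball 0 (real n)) \<in> borel_measurable M" for n
  proof (subst measurable_cong)
    show "number (A \<inter> cball 0 (real n)) x = ennreal (N (A \<inter> cball 0 (real n)) x)" if "x \<in> space M" for x
      by (rule number_eq_N[OF _ that]) (auto intro: bounded_subset[OF bounded_cball])
    have "N (A \<inter> cball 0 (real n)) \<in> borel_measurable M"
      by (rule N_measurable) (auto intro: bounded_subset[OF bounded_cball])
    then show "(\<lambda>x. ennreal (N (A \<inter> cball 0 (real n)) x)) \<in> borel_measurable M" by measurable
  qed
  ultimately show ?thesis by simp
qed

section \<open>The intensity measure and its proportionality to Lebesgue measure\<close>

definition intensity :: "(real^'d) measure" where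
  "intensity = measure_of UNIV (sets borel) (\<lambda>A. \<integral>\<^sup>+x. number A x \<partial>M)"

lemma sets_intensity [measurable_cong, simp]: "sets intensity = sets borel"
  unfolding intensity_def by (subst sets_measure_of) (auto simp: sets.sigma_sets_eq[of borel, simplified])

lemma space_intensity [simp]: "space intensity = UNIV"
  unfolding intensity_def by (subst space_measure_of) auto

lemma emeasure_intensity:
  assumes "A \<in> sets borel"
  shows "emeasure intensity A = (\<integral>\<^sup>+x. number A x \<partial>M)"
proof (rule emeasure_measure_of[OF intensity_def])
  \<comment> \<open>\<open>measure_of\<close> falls back to the zero measure unless the given set
    function is a measure.\<close>
  show "countably_additive (sets intensity) (\<lambda>A. \<integral>\<^sup>+x. number A x \<partial>M)"
  proof (rule countably_additiveI)
    fix A :: "nat \<Rightarrow> (real^'d) set"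
    assume A: "range A \<subseteq> sets intensity" "disjoint_family A"
    have "(\<Sum>i. \<integral>\<^sup>+x. number (A i) x \<partial>M) = (\<integral>\<^sup>+x. (\<Sum>i. number (A i) x) \<partial>M)"
      using A by (intro nn_integral_suminf[symmetric] number_measurable) auto
    also have "\<dots> = (\<integral>\<^sup>+x. number (\<Union>i. A i) x \<partial>M)"
    proof (rule nn_integral_cong)
      fix x
      have "(\<Sum>i. emeasure (count_space UNIV) (S x \<inter> A i)) = emeasure (count_space UNIV) (\<Union>i. S x \<inter> A i)"
        using A(2) by (intro suminf_emeasure) (auto simp: disjoint_family_on_def)
      then show "(\<Sum>i. number (A i) x) = number (\<Union>i. A i) x"
        by (simp only: number_def Int_UN_distrib)
    qed
    finally show "(\<Sum>i. \<integral>\<^sup>+x. number (A i) x \<partial>M) = (\<integral>\<^sup>+x. number (\<Union>i. A i) x \<partial>M)" .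
  qed
qed (use assms in \<open>auto simp: positive_def number_def\<close>)

lemma number_T:
  assumes "x \<in> space M" shows "number ((+) t ` A) (T t x) = number A x"
proof -
  have "(+) t ` S x \<inter> (+) t ` A = (+) t ` (S x \<inter> A)" by auto
  moreover have "emeasure (count_space UNIV) ((+) t ` (S x \<inter> A)) = emeasure (count_space UNIV) (S x \<inter> A)"
    by (simp add: emeasure_count_space finite_image_iff card_image)
  ultimately show ?thesis by (simp add: number_def S_T[OF assms])
qed

lemma intensity_translate:
  assumes A: "A \<in> sets borel" "(+) t ` A \<in> sets borel"
  shows "emeasure intensity ((+) t ` A) = emeasure intensity A"
proof -
  have "(\<integral>\<^sup>+x. number ((+) t ` A) x \<partial>M) = (\<integral>\<^sup>+x. number ((+) t ` A) x \<partial>distr M M (T t))"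
    by (simp only: distr_T)
  also have "\<dots> = (\<integral>\<^sup>+x. number ((+) t ` A) (T t x) \<partial>M)"
    using A by (intro nn_integral_distr) auto
  also have "\<dots> = (\<integral>\<^sup>+x. number A x \<partial>M)"
    by (intro nn_integral_cong number_T)
  finally show ?thesis using A by (simp add: emeasure_intensity)
qed

lemma intensity_finite:
  assumes "bounded A" "A \<in> sets borel"
  shows "emeasure intensity A < \<infinity>"
proof -
  obtain K :: nat where K: "\<forall>x\<in>space M. card (S x \<inter> A) \<le> K"
    using count_bounded[OF assms(1)] by blast
  have "(\<integral>\<^sup>+x. number A x \<partial>M) \<le> (\<integral>\<^sup>+x. of_nat K \<partial>M)"
    using K by (intro nn_integral_mono) (simp add: number_def finite_S[OF assms(1)])
  also have "\<dots> < \<infinity>" by (simp add: emeasure_space_1 ennreal_mult_less_top of_nat_less_top)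
  finally show ?thesis by (simp add: emeasure_intensity[OF assms(2)])
qed

lemma sigma_finite_intensity: "sigma_finite_measure intensity"
proof
  show "\<exists>A. countable A \<and> A \<subseteq> sets intensity \<and> \<Union> A = space intensity \<and> (\<forall>a\<in>A. emeasure intensity a \<noteq> \<infinity>)"
  proof (intro exI[of _ "range (\<lambda>n. cball 0 (real n))"] conjI)
    show "\<Union> (range (\<lambda>n. cball (0::real^'d) (real n))) = space intensity"
      by (auto intro: real_arch_simple)
    show "\<forall>a\<in>range (\<lambda>n. cball (0::real^'d) (real n)). emeasure intensity a \<noteq> \<infinity>"
      using intensity_finite[of "cball 0 _"] by (auto simp: less_top)
  qed auto
qed

text \<open>Uniqueness of the Haar measure, by integrating \<open>1\<^sub>A (x + y) 1\<^sub>Q (y)\<close> in both orders.\<close>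

lemma intensity_mult_lborel:
  assumes A[measurable]: "A \<in> sets borel" and Q[measurable]: "Q \<in> sets borel"
  shows "emeasure intensity A * emeasure lborel Q = emeasure intensity (uminus ` Q) * emeasure lborel A"
proof -
  interpret I: sigma_finite_measure intensity by (rule sigma_finite_intensity)
  interpret pair_sigma_finite intensity lborel ..
  have shift: "(+) t ` X = (\<lambda>x. x - t) -` X" for t and X :: "(real^'d) set"
    by (auto intro: image_eqI[of _ _ "_ - t"])
  have mQ: "uminus ` Q = uminus -` Q" by (auto intro: image_eqI[of _ _ "- _"])
  have A': "(+) (- y) ` A \<in> sets borel" for y
    unfolding shift using measurable_sets_borel[OF _ A, of "\<lambda>x. x - (- y)"] by simp
  have mQ': "uminus ` Q \<in> sets borel"
    unfolding mQ using measurable_sets_borel[OF _ Q, of uminus] by simp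
  have Q': "(+) z ` uminus ` Q \<in> sets borel" for z
    unfolding shift using measurable_sets_borel[OF _ mQ', of "\<lambda>x. x - z"] by simp
  have "emeasure intensity A * emeasure lborel Q = (\<integral>\<^sup>+y. emeasure intensity A * indicator Q y \<partial>lborel)"
    by (simp add: nn_integral_cmult)
  also have "\<dots> = (\<integral>\<^sup>+y. (\<integral>\<^sup>+x. indicator A (x + y) * indicator Q y \<partial>intensity) \<partial>lborel)"
  proof (rule nn_integral_cong)
    fix y
    have "(\<integral>\<^sup>+x. indicator A (x + y) * indicator Q y \<partial>intensity)
        = (\<integral>\<^sup>+x. indicator ((+) (- y) ` A) x * indicator Q y \<partial>intensity)"
      unfolding shift by (intro nn_integral_cong) (simp add: indicator_def)
    also have "\<dots> = emeasure intensity ((+) (- y) ` A) * indicator Q y"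
      using A' by (subst nn_integral_multc) (simp_all del: add_uminus_conv_diff)
    also have "\<dots> = emeasure intensity A * indicator Q y"
      by (simp only: intensity_translate[OF A A'])
    finally show "emeasure intensity A * indicator Q y
        = (\<integral>\<^sup>+x. indicator A (x + y) * indicator Q y \<partial>intensity)" ..
  qed
  also have "\<dots> = (\<integral>\<^sup>+x. (\<integral>\<^sup>+y. indicator A (x + y) * indicator Q y \<partial>lborel) \<partial>intensity)"
    by (rule Fubini') measurable
  \<comment> \<open>Substitute \<open>z = x + y\<close>, by translation invariance of Lebesgue
    measure.\<close>
  also have "\<dots> = (\<integral>\<^sup>+x. (\<integral>\<^sup>+z. indicator A z * indicator Q (z - x) \<partial>lborel) \<partial>intensity)"
  proof (rule nn_integral_cong)
    fix x :: "real^'d"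
    have "(\<integral>\<^sup>+z. indicator A z * indicator Q (z - x) \<partial>lborel)
        = (\<integral>\<^sup>+z. indicator A z * indicator Q (z - x) \<partial>distr lborel borel ((+) x))"
      by (simp only: lborel_distr_plus)
    also have "\<dots> = (\<integral>\<^sup>+y. indicator A (x + y) * indicator Q y \<partial>lborel)"
      by (subst nn_integral_distr) auto
    finally show "(\<integral>\<^sup>+y. indicator A (x + y) * indicator Q y \<partial>lborel) = (\<integral>\<^sup>+z. indicator A z * indicator Q (z - x) \<partial>lborel)" ..
  qed
  also have "\<dots> = (\<integral>\<^sup>+z. (\<integral>\<^sup>+x. indicator A z * indicator Q (z - x) \<partial>intensity) \<partial>lborel)"
    by (rule Fubini'[symmetric]) measurable
  \<comment> \<open>For fixed \<open>z\<close>, the \<open>x\<close> with \<open>z - x\<close> in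
    \<open>Q\<close> form a translate of the reflection of \<open>Q\<close>, whose intensity does
    not depend on \<open>z\<close>.\<close>
  also have "\<dots> = (\<integral>\<^sup>+z. emeasure intensity (uminus ` Q) * indicator A z \<partial>lborel)"
  proof (rule nn_integral_cong)
    fix z
    have "(\<integral>\<^sup>+x. indicator A z * indicator Q (z - x) \<partial>intensity)
        = (\<integral>\<^sup>+x. indicator A z * indicator ((+) z ` uminus ` Q) x \<partial>intensity)"
      unfolding shift mQ by (intro nn_integral_cong) (simp add: indicator_def)
    also have "\<dots> = emeasure intensity (uminus ` Q) * indicator A z"
      using Q' mQ' by (simp add: nn_integral_cmult intensity_translate mult.commute)
    finally show "(\<integral>\<^sup>+x. indicator A z * indicator Q (z - x) \<partial>intensity)
        = emeasure intensity (uminus ` Q) * indicator A z" .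
  qed
  also have "\<dots> = emeasure intensity (uminus ` Q) * emeasure lborel A"
    by (simp add: nn_integral_cmult)
  finally show ?thesis .
qed

text \<open>With the unit box for \<open>Q\<close>, the factor is the intensity of its reflection;
  taking the unit box for \<open>A\<close> as well shows that this equals the intensity of the box
  itself.\<close>

lemma intensity_eq_lborel:
  assumes "A \<in> sets borel"
  shows "emeasure intensity A = emeasure intensity (slab {} 0) * emeasure lborel A"
  using intensity_mult_lborel[OF assms slab_borel, of "{}" 0]
    intensity_mult_lborel[OF slab_borel slab_borel, of "{}" 0 "{}" 0]
  by (simp add: emeasure_lborel_unit_slab)

text \<open>The link between spatial averages and the Palm measure: the constant is the integral of
  the limit in \<open>slab_averages\<close>.\<close>

lemma expected_number:
  assumes "A \<in> sets borel"
  shows "(\<integral>\<^sup>+x. number A x \<partial>M) = ennreal (expectation (N (slab {} 0))) * emeasure lborel A"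
proof -
  have "emeasure intensity (slab {} 0) = (\<integral>\<^sup>+x. ennreal (N (slab {} 0) x) \<partial>M)"
    unfolding emeasure_intensity[OF slab_borel]
    by (intro nn_integral_cong number_eq_N slab_bounded)
  also have "\<dots> = ennreal (expectation (N (slab {} 0)))"
  proof (rule nn_integral_eq_integral)
    obtain K :: nat where "\<forall>x\<in>space M. card (S x \<inter> slab {} 0) \<le> K"
      using count_bounded[OF slab_bounded, of "{}" 0] by blast
    then show "integrable M (N (slab {} 0))"
      by (intro integrable_bounded_measurable[of _ "real K"] N_measurable slab_bounded slab_borel)
        (auto simp: N_def)
  qed (simp add: N_nonneg)
  finally show ?thesis
    using intensity_eq_lborel[OF assms] by (simp add: emeasure_intensity[OF assms])
qed

end

section \<open>Constant density under ergodicity\<close>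

locale ergodic_point_set = stationary_point_set +
  assumes trivial_invariant:
    "\<And>D. D \<in> sets M \<Longrightarrow> (\<And>t x. x \<in> space M \<Longrightarrow> T t x \<in> D \<longleftrightarrow> x \<in> D) \<Longrightarrow> prob D = 0 \<or> prob D = 1"
begin

text \<open>The limit \<open>g\<close> agrees almost everywhere with \<open>upper_density\<close>,
  whose sublevel sets are exactly invariant; so the sublevel sets of \<open>g\<close> have
  probability 0 or 1.\<close>

lemma slab_density:
  "AE x in M. (\<lambda>n. N (slab UNIV n) x / (2 * real n) ^ CARD('b)) \<longlonglongrightarrow> expectation (N (slab {} 0))"
proof -
  obtain g K where g[measurable]: "g \<in> borel_measurable M" and gK: "\<forall>x\<in>space M. \<bar>g x\<bar> \<le> K"
    and lim: "AE x in M. (\<lambda>n. N (slab UNIV n) x / (2 * real n) ^ card (UNIV :: 'b set)) \<longlonglongrightarrow> g x"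
    and int: "(\<integral>x. g x \<partial>M) = (\<integral>x. N (slab {} 0) x \<partial>M)"
    using slab_averages[of UNIV, OF finite] by (elim exE conjE)
  have ud: "AE x in M. upper_density x = ereal (g x)"
    using lim
  proof eventually_elim
    case (elim x)
    then show ?case unfolding upper_density_def by (intro lim_imp_Limsup) auto
  qed
  have "AE x in M. g x = expectation g"
  proof (rule AE_eq_expectation_if_trivial_sublevels)
    show "integrable M g" using gK by (intro integrable_bounded_measurable[of _ K]) auto
    fix c
    have "prob {x \<in> space M. g x \<le> c} = prob {x \<in> space M. upper_density x \<le> ereal c}"
      using ud by (intro finite_measure_eq_AE) auto
    moreover have "prob {x \<in> space M. upper_density x \<le> ereal c} = 0
      \<or> prob {x \<in> space M. upper_density x \<le> ereal c} = 1"
      by (rule trivial_invariant) (auto simp: upper_density_T T_space)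
    ultimately show "prob {x \<in> space M. g x \<le> c} = 0 \<or> prob {x \<in> space M. g x \<le> c} = 1" by simp
  qed simp
  with lim show ?thesis
    by eventually_elim (simp add: int)
qed

text \<open>\<open>L R x\<close> stands for a count in the cube of edge length \<open>R\<close> that
  may lose points near the boundary; \<open>p\<close> is the width of the layer that the lower
  comparison gives away.\<close>

lemma cube_density:
  assumes lower: "\<And>x n R. x \<in> space M \<Longrightarrow> 2 * real (n + p) \<le> R \<Longrightarrow> N (slab UNIV n) x \<le> L R x"
    and upper: "\<And>x n R. x \<in> space M \<Longrightarrow> R \<le> 2 * real n \<Longrightarrow> L R x \<le> N (slab UNIV n) x"
  shows "AE x in M. ((\<lambda>R. L R x / R ^ CARD('b)) \<longlongrightarrow> expectation (N (slab {} 0))) at_top"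
  using slab_density AE_space
proof eventually_elim
  case (elim x)
  \<comment> \<open>The largest admissible inner half-side and the smallest admissible outer one.
    For \<open>R \<ge> 2 * real p + 2\<close> the truncated subtraction is harmless.\<close>
  let ?l = "\<lambda>R. nat \<lfloor>R / 2\<rfloor> - p" and ?u = "\<lambda>R. nat \<lceil>R / 2\<rceil>"
  have R: "\<forall>\<^sub>F R in at_top. 2 * real p + 2 \<le> R" by (rule eventually_ge_at_top)
  have l: "\<bar>2 * real (?l R) - R\<bar> \<le> 2 * real p + 2 \<and> 2 * real (?l R + p) \<le> R" if "2 * real p + 2 \<le> R" for R
  proof -
    obtain j where j: "j = \<lfloor>R / 2\<rfloor>" by blast
    have f: "real p \<le> real_of_int j" "real_of_int j \<le> R / 2" "R / 2 < real_of_int j + 1"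
      using that unfolding j by linarith+
    then have "real (nat j - p) = real_of_int j - real p" by (simp add: of_nat_diff le_nat_iff)
    then show ?thesis
      using f unfolding j[symmetric] of_nat_add abs_le_iff by (auto simp: field_simps)
  qed
  have u: "\<bar>2 * real (?u R) - R\<bar> \<le> 2 * real p + 2 \<and> R \<le> 2 * real (?u R)" if "2 * real p + 2 \<le> R" for R
  proof -
    obtain j where j: "j = \<lceil>R / 2\<rceil>" by blast
    have f: "R / 2 \<le> real_of_int j" "real_of_int j < R / 2 + 1" unfolding j by linarith+
    then have "real (nat j) = real_of_int j" using that by simp
    then show ?thesis using f unfolding j[symmetric] abs_le_iff by (auto simp: field_simps)
  qed
  show ?case
  proof (rule tendsto_sandwich)
    show "((\<lambda>R. N (slab UNIV (?l R)) x / R ^ CARD('b)) \<longlongrightarrow> expectation (N (slab {} 0))) at_top"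
      by (rule density_along_scales[OF elim(1), where q="2 * real p + 2"], rule eventually_mono[OF R])
        (rule conjunct1[OF l])
    show "((\<lambda>R. N (slab UNIV (?u R)) x / R ^ CARD('b)) \<longlongrightarrow> expectation (N (slab {} 0))) at_top"
      by (rule density_along_scales[OF elim(1), where q="2 * real p + 2"], rule eventually_mono[OF R])
        (rule conjunct1[OF u])
    show "\<forall>\<^sub>F R in at_top. N (slab UNIV (?l R)) x / R ^ CARD('b) \<le> L R x / R ^ CARD('b)"
      using R by eventually_elim (intro divide_right_mono lower elim(2), use l in auto)
    show "\<forall>\<^sub>F R in at_top. L R x / R ^ CARD('b) \<le> N (slab UNIV (?u R)) x / R ^ CARD('b)"
      using R by eventually_elim (intro divide_right_mono upper elim(2), use u in auto)
  qed
qed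

end

section \<open>Integer-valued Radon measures\<close>

lemma closed_colour_space: "closed (colour_space m :: ((real^'d) \<times> nat) set)"
  unfolding colour_space_def by (intro closed_Times) (auto intro: finite_imp_closed)

lemma colour_space_borel [measurable]: "colour_space m \<in> sets borel"
  by (intro borel_closed closed_colour_space)

lemma Mp_space: "lam \<in> Mp m \<Longrightarrow> space lam = colour_space m"
  by (simp add: Mp_def radon_measure_def)

lemma Mp_sets: "lam \<in> Mp m \<Longrightarrow> sets lam = sets (restrict_space borel (colour_space m))"
  by (simp add: Mp_def radon_measure_def)

lemma Mp_sets_iff: "lam \<in> Mp m \<Longrightarrow> A \<in> sets lam \<longleftrightarrow> A \<in> sets borel \<and> A \<subseteq> colour_space m"
  by (subst Mp_sets, assumption) (auto simp: sets_restrict_space_iff)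

lemma bounded_subset_window:
  fixes A :: "((real^'d) \<times> nat) set"
  assumes "A \<subseteq> colour_space m" "bounded (fst ` A)"
  shows "\<exists>n::nat. A \<subseteq> ball 0 (real n) \<times> {1..m}"
proof -
  obtain b where b: "\<forall>x\<in>fst ` A. norm x \<le> b" using assms(2) by (auto simp: bounded_iff)
  obtain n :: nat where n: "b < real n" using reals_Archimedean2 by blast
  have "A \<subseteq> ball 0 (real n) \<times> {1..m}"
    using assms(1) b n unfolding colour_space_def by force
  then show ?thesis ..
qed

lemma compact_closure_if_bounded:
  fixes A :: "((real^'d) \<times> nat) set"
  assumes "A \<subseteq> colour_space m" "bounded (fst ` A)"
  shows "compact (closure A)" "closure A \<subseteq> colour_space m"
proof -
  obtain n :: nat where n: "A \<subseteq> ball 0 (real n) \<times> {1..m}"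
    using bounded_subset_window[OF assms] by blast
  have c: "compact (cball (0::real^'d) (real n) \<times> {1..m})"
    by (intro compact_Times compact_cball finite_imp_compact) auto
  have "closure A \<subseteq> cball 0 (real n) \<times> {1..m}"
    using n by (intro closure_minimal compact_imp_closed c) auto
  then show "compact (closure A)"
    using compact_Int_closed[OF c closed_closure[of A]] by (simp add: Int_absorb1)
  show "closure A \<subseteq> colour_space m"
    using assms(1) by (intro closure_minimal closed_colour_space)
qed

lemma Mp_emeasure_bounded:
  fixes A :: "((real^'d) \<times> nat) set"
  assumes lam: "lam \<in> Mp m" and A: "A \<in> sets borel" "A \<subseteq> colour_space m" "bounded (fst ` A)"
  shows "emeasure lam A < \<infinity>" "emeasure lam A \<in> \<nat>"
proof -
  have A': "A \<in> sets lam" using A lam by (simp add: Mp_sets_iff)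
  have cl: "closure A \<in> sets lam"
    using compact_closure_if_bounded[OF A(2,3)] lam by (simp add: Mp_sets_iff)
  have "emeasure lam A \<le> emeasure lam (closure A)"
    by (intro emeasure_mono closure_subset cl)
  also have "\<dots> < \<infinity>"
    using lam compact_closure_if_bounded[OF A(2,3)] by (auto simp: Mp_def radon_measure_def)
  finally show "emeasure lam A < \<infinity>" .
  show "emeasure lam A \<in> \<nat>"
    using lam A' compact_closure_if_bounded[OF A(2,3)] by (auto simp: Mp_def)
qed

section \<open>Translation of sets, measures and point sets\<close>

lemma shift_0 [simp]: "shift 0 = id"
  by (auto simp: shift_def)

lemma shift_shift [simp]: "shift s (shift t p) = shift (s + t) p"
  by (simp add: shift_def add.assoc)

lemma fst_shift [simp]: "fst (shift t p) = t + fst p" and snd_shift [simp]: "snd (shift t p) = snd p"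
  by (simp_all add: shift_def)

lemma shift_colour_space_iff [simp]: "shift t p \<in> colour_space m \<longleftrightarrow> p \<in> colour_space m"
  by (auto simp: colour_space_def shift_def mem_Times_iff)

lemma shift_vimage: "shift t -` A = shift (- t) ` A"
proof (intro equalityI subsetI)
  fix p assume "p \<in> shift t -` A"
  then show "p \<in> shift (- t) ` A" by (intro image_eqI[of _ _ "shift t p"]) auto
qed auto

lemma continuous_shift: "continuous_on A (shift t)"
  unfolding shift_def by (intro continuous_intros)

lemma compact_closure_shift:
  assumes "compact (closure A)"
  shows "compact (closure (shift t ` A))"
proof -
  have c: "compact (shift t ` closure A)"
    by (intro compact_continuous_image continuous_shift assms)
  have "closure (shift t ` A) \<subseteq> shift t ` closure A"
    by (intro closure_minimal image_mono closure_subset compact_imp_closed c)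
  then have "closure (shift t ` A) = shift t ` closure A \<inter> closure (shift t ` A)" by blast
  also have "compact \<dots>" by (intro compact_Int_closed c closed_closure)
  finally show ?thesis .
qed

lemma shift_image_borel: "A \<in> sets borel \<Longrightarrow> shift t ` A \<in> sets borel"
  using measurable_sets_borel[OF borel_measurable_continuous_onI[OF continuous_shift, of "- t"], of A]
  by (simp add: shift_vimage)

lemma shift_measurable: "lam \<in> Mp m \<Longrightarrow> shift t \<in> measurable lam lam"
  by (intro measurableI)
    (auto simp: Mp_space Mp_sets_iff shift_vimage shift_image_borel)

lemma shift_image_colour_space: "A \<subseteq> colour_space m \<Longrightarrow> shift t ` A \<subseteq> colour_space m"
  by auto

lemma emeasure_translate:
  assumes "lam \<in> Mp m" "A \<in> sets lam"
  shows "emeasure (translate t lam) A = emeasure lam (shift (- t) ` A)"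
proof -
  have "shift t -` A \<inter> space lam = shift (- t) ` A"
    using assms by (auto simp: Mp_sets_iff Mp_space shift_vimage)
  then show ?thesis
    unfolding translate_def using assms by (simp add: emeasure_distr shift_measurable)
qed

lemma translate_in_Mp:
  assumes lam: "lam \<in> Mp m"
  shows "translate t lam \<in> Mp m"
proof -
  have sh: "shift (- t) ` A \<in> sets lam" if "A \<in> sets lam" for A
    using that lam by (auto simp: Mp_sets_iff shift_image_borel)
  have co: "compact (shift s ` K)" if "compact K" for s K
    by (intro compact_continuous_image continuous_shift that)
  have comp_sets: "K \<in> sets lam" if "compact K" "K \<subseteq> colour_space m" for K
    using that lam by (simp add: Mp_sets_iff compact_imp_closed borel_closed)
  have sets: "sets (translate t lam) = sets lam" "space (translate t lam) = space lam"
    by (simp_all add: translate_def)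
  have fin: "emeasure lam K < \<infinity>" if "compact K" "K \<subseteq> colour_space m" for K
    using lam that by (auto simp: Mp_def radon_measure_def)
  have reg: "emeasure lam A = (SUP K\<in>{K. compact K \<and> K \<subseteq> A}. emeasure lam K)" if "A \<in> sets lam" for A
    using lam that by (auto simp: Mp_def radon_measure_def)
  show ?thesis
    unfolding Mp_def radon_measure_def mem_Collect_eq sets
  proof (intro conjI allI impI ballI)
    show "space lam = colour_space m" using lam by (rule Mp_space)
    show "sets lam = sets (restrict_space borel (colour_space m))" using lam by (rule Mp_sets)
    show "emeasure (translate t lam) K < \<infinity>" if "compact K \<and> K \<subseteq> colour_space m" for K
      using that emeasure_translate[OF lam comp_sets, of K t] fin[OF co shift_image_colour_space, of K "- t"] by auto
    show "emeasure (translate t lam) A = (SUP K\<in>{K. compact K \<and> K \<subseteq> A}. emeasure (translate t lam) K)"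
      if A: "A \<in> sets lam" for A
    proof -
      \<comment> \<open>Compact subsets of the shifted set are the shifts of compact subsets, so
        inner regularity carries over.\<close>
      have "{K. compact K \<and> K \<subseteq> shift (- t) ` A} = (`) (shift (- t)) ` {K. compact K \<and> K \<subseteq> A}"
      proof (intro equalityI subsetI)
        fix K assume K: "K \<in> {K. compact K \<and> K \<subseteq> shift (- t) ` A}"
        have "shift t ` K \<subseteq> shift t ` shift (- t) ` A" using K by blast
        also have "\<dots> = A" by (simp add: image_image)
        finally show "K \<in> (`) (shift (- t)) ` {K. compact K \<and> K \<subseteq> A}"
          using K by (intro image_eqI[of _ _ "shift t ` K"]) (auto simp: image_image co)
      qed (auto simp: co)
      then have "emeasure lam (shift (- t) ` A)
          = (SUP K\<in>{K. compact K \<and> K \<subseteq> A}. emeasure lam (shift (- t) ` K))"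
        unfolding reg[OF sh[OF A]] by (simp add: image_image)
      also have "\<dots> = (SUP K\<in>{K. compact K \<and> K \<subseteq> A}. emeasure (translate t lam) K)"
        using A lam by (intro SUP_cong refl emeasure_translate[OF lam, symmetric] comp_sets) (auto simp: Mp_sets_iff)
      finally show ?thesis using emeasure_translate[OF lam A] by simp
    qed
    show "emeasure (translate t lam) A \<in> \<nat>" if A: "A \<in> sets lam" "compact (closure A)" for A
    proof -
      have "compact (closure (shift (- t) ` A))"
        using A by (intro compact_closure_shift)
      then show ?thesis
        unfolding emeasure_translate[OF lam A(1)] using lam sh[OF A(1)] by (auto simp: Mp_def)
    qed
  qed
qed

lemma translate_translate:
  assumes "lam \<in> Mp m"
  shows "translate s (translate t lam) = translate (s + t) lam"
proof (rule measure_eqI)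
  show "sets (translate s (translate t lam)) = sets (translate (s + t) lam)"
    by (simp add: translate_def)
  fix A assume A: "A \<in> sets (translate s (translate t lam))"
  then have A: "A \<in> sets lam" by (simp add: translate_def)
  then have "A \<in> sets (translate t lam)" "shift (- s) ` A \<in> sets lam"
    using assms by (auto simp: translate_def Mp_sets_iff shift_image_borel)
  with A show "emeasure (translate s (translate t lam)) A = emeasure (translate (s + t) lam) A"
    using assms by (simp add: emeasure_translate[OF translate_in_Mp] emeasure_translate image_image add.commute)
qed

lemma translate_0:
  assumes "lam \<in> Mp m" shows "translate 0 lam = lam"
proof (rule measure_eqI)
  show "emeasure (translate 0 lam) A = emeasure lam A" if "A \<in> sets (translate 0 lam)" for A
    using that assms emeasure_translate[OF assms, of A 0] by (simp add: translate_def)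
qed (simp add: translate_def)

lemma singleton_sets: "lam \<in> Mp m \<Longrightarrow> p \<in> colour_space m \<Longrightarrow> {p} \<in> sets lam"
  by (simp add: Mp_sets_iff)

lemma points_translate:
  assumes lam: "lam \<in> Mp m"
  shows "points (translate t lam) = shift t ` points lam"
proof -
  have "p \<in> points (translate t lam) \<longleftrightarrow> shift (- t) p \<in> points lam" for p
  proof (cases "p \<in> colour_space m")
    case True
    then show ?thesis
      using emeasure_translate[OF lam singleton_sets[OF lam True], of t] lam
      by (simp add: points_def translate_def Mp_space)
  next
    case False
    then show ?thesis using lam by (simp add: points_def translate_def Mp_space)
  qed
  then have "points (translate t lam) = shift (- t) -` points lam" by blast
  then show ?thesis by (simp add: shift_vimage)
qed

section \<open>Continuity and measurability for the vague topology\<close>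

lemma Cc_measurable:
  assumes "f \<in> Cc m" "lam \<in> Mp m"
  shows "f \<in> borel_measurable lam"
proof -
  have "f \<in> borel_measurable (restrict_space borel (colour_space m))"
    using assms(1) by (intro borel_measurable_continuous_on_restrict) (simp add: Cc_def)
  then show ?thesis
    using measurable_cong_sets[OF Mp_sets[OF assms(2)] refl] by blast
qed

lemma Cc_shift:
  assumes "f \<in> Cc m"
  shows "f \<circ> shift t \<in> Cc m"
proof -
  have "continuous_on (colour_space m) (f \<circ> shift t)"
  proof (rule continuous_on_compose[OF continuous_shift])
    have "continuous_on (colour_space m) f" using assms by (simp add: Cc_def)
    then show "continuous_on (shift t ` colour_space m) f"
      by (rule continuous_on_subset) (rule shift_image_colour_space[OF order_refl])
  qed
  moreover have "{p \<in> colour_space m. (f \<circ> shift t) p \<noteq> 0} = shift (- t) ` {p \<in> colour_space m. f p \<noteq> 0}"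
    unfolding shift_vimage[symmetric] by (simp add: set_eq_iff)
  moreover have "compact (closure (shift (- t) ` {p \<in> colour_space m. f p \<noteq> 0}))"
    using assms by (intro compact_closure_shift) (simp add: Cc_def)
  ultimately show ?thesis unfolding Cc_def mem_Collect_eq by (simp only:)
qed

text \<open>It suffices to pull back the generating sets: integrating \<open>f\<close> against a
  translate means integrating \<open>f \<circ> shift t\<close>, again a test function. Continuity
  yields the measurability of the action and, through closed preimages, the invariance of the
  support.\<close>

lemma continuous_translate: "continuous_map (vague_topology m) (vague_topology m) (translate t)"
proof -
  have "openin (vague_topology m) (translate t -` U \<inter> topspace (vague_topology m))"
    if U: "U \<in> {{lam \<in> Mp m. integral\<^sup>L lam f \<in> U} |f U. f \<in> Cc m \<and> open U}" for U
  proof -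
    obtain f W where U: "U = {lam \<in> Mp m. integral\<^sup>L lam f \<in> W}" and f: "f \<in> Cc m" and W: "open W"
      using U by blast
    have "integral\<^sup>L (translate t lam) f = integral\<^sup>L lam (f \<circ> shift t)" if "lam \<in> Mp m" for lam
      unfolding translate_def o_def using that f by (intro integral_distr shift_measurable Cc_measurable)
    then have "translate t -` U \<inter> topspace (vague_topology m) = {lam \<in> Mp m. integral\<^sup>L lam (f \<circ> shift t) \<in> W}"
      unfolding U topspace_vague_topology using translate_in_Mp by auto
    moreover have "openin (vague_topology m) {lam \<in> Mp m. integral\<^sup>L lam (f \<circ> shift t) \<in> W}"
      unfolding vague_topology_def using Cc_shift[OF f] W
      by (intro topology_generated_by_Basis) blast
    ultimately show ?thesis by simp
  qed
  moreover have "translate t ` topspace (vague_topology m)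
      \<subseteq> \<Union> {{lam \<in> Mp m. integral\<^sup>L lam f \<in> U} |f U. f \<in> Cc m \<and> open U}"
    using topspace_vague_topology[of m] translate_in_Mp[of _ m]
    unfolding vague_topology_def topology_generated_by_topspace by blast
  ultimately show ?thesis
    unfolding vague_topology_def[of m] continuous_on_generated_topo_iff
    by (simp add: vague_topology_def[of m])
qed

lemma openin_vague_subset: "{U. openin (vague_topology m) U} \<subseteq> Pow (Mp m)"
  using openin_subset[of "vague_topology m"] unfolding topspace_vague_topology by blast

lemma space_vague_borel [simp]: "space (vague_borel m) = Mp m"
  unfolding vague_borel_def by (rule space_measure_of) (rule openin_vague_subset)

lemma sets_vague_borel: "sets (vague_borel m) = sigma_sets (Mp m) {U. openin (vague_topology m) U}"
  unfolding vague_borel_def by (rule sets_measure_of) (rule openin_vague_subset)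

lemma openin_vague_sets: "openin (vague_topology m) U \<Longrightarrow> U \<in> sets (vague_borel m)"
  by (simp add: sets_vague_borel)

lemma closedin_vague_sets:
  assumes "closedin (vague_topology m) C" shows "C \<in> sets (vague_borel m)"
proof -
  have "Mp m - C \<in> sets (vague_borel m)" "C \<subseteq> Mp m"
    using assms by (auto simp: closedin_def topspace_vague_topology intro: openin_vague_sets)
  then show ?thesis
    using sets.compl_sets[of "Mp m - C" "vague_borel m"] by (simp add: double_diff)
qed

lemma translate_measurable:
  fixes t :: "real^'d"
  shows "translate t \<in> measurable (vague_borel m) (vague_borel m)"
proof (rule measurable_sigma_sets[OF sets_vague_borel])
  show "{U. openin (vague_topology m) U} \<subseteq> Pow (Mp m)"
    by (rule openin_vague_subset)
  show "translate t \<in> space (vague_borel m) \<rightarrow> Mp m"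
    by (simp add: translate_in_Mp)
  fix U :: "((real^'d) \<times> nat) measure set"
  assume "U \<in> {U. openin (vague_topology m) U}"
  then have "openin (vague_topology m) {lam \<in> topspace (vague_topology m). translate t lam \<in> U}"
    using continuous_translate[of m t] by (intro openin_continuous_map_preimage) auto
  then have "openin (vague_topology m) (translate t -` U \<inter> space (vague_borel m))"
    by (simp add: topspace_vague_topology vimage_def Int_def conj_commute)
  then show "translate t -` U \<inter> space (vague_borel m) \<in> sets (vague_borel m)"
    by (rule openin_vague_sets)
qed

lemma Cc_integral_measurable:
  assumes "f \<in> Cc m"
  shows "(\<lambda>lam. integral\<^sup>L lam f) \<in> borel_measurable (vague_borel m)"
proof (rule borel_measurableI)
  fix W :: "real set" assume "open W"
  then have "openin (vague_topology m) {lam \<in> Mp m. integral\<^sup>L lam f \<in> W}"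
    unfolding vague_topology_def using assms by (intro topology_generated_by_Basis) blast
  then show "(\<lambda>lam. integral\<^sup>L lam f) -` W \<inter> space (vague_borel m) \<in> sets (vague_borel m)"
    by (auto simp: vimage_def Int_def conj_commute intro!: openin_vague_sets)
qed

text \<open>The indicator of \<open>G\<close> is an increasing limit of test functions, truncated
  multiples of the distance to the complement within each colour. The mass of \<open>G\<close> is
  thus a supremum of vaguely continuous functionals.\<close>

lemma emeasure_open_measurable:
  fixes G :: "((real^'d) \<times> nat) set"
  assumes G: "open G" "G \<subseteq> colour_space m" "bounded (fst ` G)"
  shows "(\<lambda>lam. emeasure lam G) \<in> borel_measurable (vague_borel m)"
proof -
  define H where "H i = - {x. (x, i) \<in> G}" for i
  define f where "f k p = min 1 (real k * infdist (fst p) (H (snd p)))" for k p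
  have closed_H: "closed (H i)" for i
  proof -
    have "{x. (x, i) \<in> G} = (\<lambda>x. (x, i)) -` G" by auto
    moreover have "open ((\<lambda>x. (x, i)) -` G)"
      by (intro open_vimage G continuous_intros)
    ultimately show ?thesis by (simp add: H_def closed_Compl)
  qed
  \<comment> \<open>\<open>infdist\<close> to the empty set is \<open>0\<close> by convention;
    boundedness of \<open>G\<close> keeps the complements nonempty.\<close>
  have ne: "H i \<noteq> {}" for i
  proof
    assume "H i = {}"
    then have "fst ` G = UNIV" by (force simp: H_def)
    then show False using G(3) not_bounded_UNIV by metis
  qed
  have f0: "f k p = 0" if "p \<notin> G" for k p
    using that by (simp add: f_def H_def)
  have f_nonneg: "0 \<le> f k p" "f k p \<le> 1" for k p
    by (auto simp: f_def infdist_nonneg)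
  have f_mono: "f k p \<le> f l p" if "k \<le> l" for k l p
    unfolding f_def using that by (intro min.mono mult_right_mono infdist_nonneg) auto
  have f_cont: "continuous_on A (f k)" for A k
  proof (rule continuous_on_subset)
    \<comment> \<open>\<open>H (snd p)\<close> jumps with the colour, which is harmless because
      colour slices are open.\<close>
    have "continuous_on (\<Union>i\<in>UNIV. UNIV \<times> {i}) (f k)"
    proof (rule continuous_on_open_UN)
      fix i :: nat
      show "open (UNIV \<times> {i} :: ((real^'d) \<times> nat) set)" by (intro open_Times open_UNIV) (rule discrete_topology_class.open_discrete)
      have "continuous_on (UNIV \<times> {i}) (\<lambda>p. min 1 (real k * infdist (fst p) (H i)))"
        by (intro continuous_intros)
      then show "continuous_on (UNIV \<times> {i}) (f k)"
        by (rule continuous_on_eq) (auto simp: f_def)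
    qed
    also have "(\<Union>i\<in>UNIV. UNIV \<times> {i}) = (UNIV :: ((real^'d) \<times> nat) set)" by auto
    finally show "continuous_on UNIV (f k)" .
  qed simp
  have f_Cc: "f k \<in> Cc m" for k
  proof -
    have sub: "{p \<in> colour_space m. f k p \<noteq> 0} \<subseteq> G" using f0 by blast
    have "compact (closure {p \<in> colour_space m. f k p \<noteq> 0})"
      by (rule compact_closure_if_bounded(1)[of _ m])
        (use bounded_subset[OF G(3) image_mono[OF sub]] in auto)
    then show ?thesis using f_cont by (simp add: Cc_def)
  qed
  have "emeasure lam G = (SUP k. ennreal (integral\<^sup>L lam (f k)))" if lam: "lam \<in> Mp m" for lam
  proof -
    have Gs: "G \<in> sets lam" using G lam by (simp add: Mp_sets_iff)
    have fin: "emeasure lam G < \<infinity>" using Mp_emeasure_bounded(1)[OF lam _ G(2,3)] G(1) by simp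
    have [measurable]: "f k \<in> borel_measurable lam" for k by (rule Cc_measurable[OF f_Cc lam])
    have int: "integrable lam (f k)" for k
    proof (rule Bochner_Integration.integrable_bound)
      show "integrable lam (indicator G :: _ \<Rightarrow> real)" using Gs fin by simp
      show "AE p in lam. norm (f k p) \<le> norm (indicator G p :: real)"
        using f0 f_nonneg by (auto simp: indicator_def)
    qed simp
    have "emeasure lam G = (\<integral>\<^sup>+p. indicator G p \<partial>lam)" using Gs by simp
    also have "\<dots> = (\<integral>\<^sup>+p. (SUP k. ennreal (f k p)) \<partial>lam)"
    proof (rule nn_integral_cong)
      fix p
      have inc: "incseq (\<lambda>k. ennreal (f k p))"
        unfolding incseq_def using f_mono ennreal_leI by blast
      have "(\<lambda>k. f k p) \<longlonglongrightarrow> indicator G p"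
      proof (cases "p \<in> G")
        case True
        let ?d = "infdist (fst p) (H (snd p))"
        have "fst p \<notin> H (snd p)" using True by (simp add: H_def)
        then have "0 < ?d"
          using in_closed_iff_infdist_zero[OF closed_H ne, of "fst p"] infdist_nonneg[of "fst p" "H (snd p)"]
          by (auto simp: less_le)
        then obtain k0 :: nat where k0: "1 < real k0 * ?d"
          using reals_Archimedean3 by blast
        then have "f k p = 1" if "k \<ge> k0" for k
        proof -
          have "real k0 * ?d \<le> real k * ?d"
            using that \<open>0 < ?d\<close> by (intro mult_right_mono) auto
          with k0 show ?thesis unfolding f_def by linarith
        qed
        then show ?thesis
          using True by (intro tendsto_eventually) (auto simp: eventually_sequentially)
      qed (simp add: f0)
      then have "(\<lambda>k. ennreal (f k p)) \<longlonglongrightarrow> indicator G p"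
        by (metis ennreal_indicator tendsto_ennrealI)
      then show "indicator G p = (SUP k. ennreal (f k p))"
        using LIMSEQ_SUP[OF inc] LIMSEQ_unique by blast
    qed
    also have "\<dots> = (SUP k. \<integral>\<^sup>+p. ennreal (f k p) \<partial>lam)"
    proof (rule nn_integral_monotone_convergence_SUP)
      show "incseq (\<lambda>k p. ennreal (f k p))"
        unfolding incseq_def le_fun_def using f_mono ennreal_leI by blast
    qed measurable
    also have "\<dots> = (SUP k. ennreal (integral\<^sup>L lam (f k)))"
      using int f_nonneg by (intro SUP_cong refl nn_integral_eq_integral) auto
    finally show ?thesis .
  qed
  moreover have "(\<lambda>lam. SUP k. ennreal (integral\<^sup>L lam (f k))) \<in> borel_measurable (vague_borel m)"
    using Cc_integral_measurable[OF f_Cc] by measurable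
  ultimately show ?thesis by (subst measurable_cong) auto
qed

text \<open>Dynkin's argument, starting from open sets. Intersecting with the bounded window
  \<open>W\<close> keeps masses finite, so that complements can be treated by subtraction.\<close>

lemma emeasure_window_measurable:
  fixes A W :: "((real^'d) \<times> nat) set"
  assumes A: "A \<in> sets borel" and W: "open W" "W \<subseteq> colour_space m" "bounded (fst ` W)"
  shows "(\<lambda>lam. emeasure lam (A \<inter> W)) \<in> borel_measurable (vague_borel m)"
proof -
  have "Int_stable {S :: ((real^'d) \<times> nat) set. open S}" by (auto simp: Int_stable_def)
  moreover have "{S :: ((real^'d) \<times> nat) set. open S} \<subseteq> Pow UNIV" by simp
  moreover have "A \<in> sigma_sets UNIV {S. open S}" using A by (simp add: sets_borel)
  ultimately show ?thesis
  proof (induction A rule: sigma_sets_induct_disjoint)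
    case (basic A)
    then show ?case
      using W by (intro emeasure_open_measurable) (auto intro: bounded_subset)
  next
    case (compl A)
    have AB: "A \<in> sets borel" using compl by (simp add: sets_borel)
    have "emeasure lam ((UNIV - A) \<inter> W) = emeasure lam W - emeasure lam (A \<inter> W)" if lam: "lam \<in> Mp m" for lam
    proof -
      have "A \<inter> W \<in> sets lam" "W \<in> sets lam"
        using lam AB W by (auto simp: Mp_sets_iff)
      moreover have "emeasure lam (A \<inter> W) < \<infinity>"
        using lam AB W by (intro Mp_emeasure_bounded(1)) (auto intro: bounded_subset)
      moreover have "(UNIV - A) \<inter> W = W - A \<inter> W" by auto
      ultimately show ?thesis by (simp add: emeasure_Diff)
    qed
    then show ?case
      using compl.IH emeasure_open_measurable[OF W]
      by (subst measurable_cong[where g="\<lambda>lam. emeasure lam W - emeasure lam (A \<inter> W)"]) auto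
  next
    case (union A)
    have AB: "A i \<in> sets borel" for i using union by (auto simp: sets_borel)
    have "emeasure lam (\<Union> (range A) \<inter> W) = (\<Sum>i. emeasure lam (A i \<inter> W))" if lam: "lam \<in> Mp m" for lam
    proof -
      have "(\<Sum>i. emeasure lam (A i \<inter> W)) = emeasure lam (\<Union>i. A i \<inter> W)"
        using union.hyps lam AB W
        by (intro suminf_emeasure) (auto simp: Mp_sets_iff disjoint_family_on_def)
      then show ?thesis by (simp only: Int_UN_distrib2 UN_extend_simps)
    qed
    then show ?case
      using union.IH by (subst measurable_cong[where g="\<lambda>lam. \<Sum>i. emeasure lam (A i \<inter> W)"]) auto
  qed auto
qed

section \<open>Cubes and finite covers\<close>

lemma cube_eq_box: "cube R = box (\<chi> i. - (R / 2)) (\<chi> i. R / 2)"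
proof -
  have "\<bar>a\<bar> < b \<longleftrightarrow> - b < a \<and> a < b" for a b :: real by linarith
  then show ?thesis unfolding cube_def set_eq_iff mem_Collect_eq mem_box_cart vec_lambda_beta by (simp only: simp_thms)
qed

text \<open>For measures in \<open>Mp_ud m r\<close> a cube holds at most one point, so the size of
  the cover bounds the number of points over \<open>A\<close> for all configurations
  simultaneously.\<close>

lemma bounded_finite_cube_cover:
  fixes A :: "(real^'d) set"
  assumes "r > 0" "bounded A"
  shows "\<exists>C. finite C \<and> A \<subseteq> (\<Union>a\<in>C. (+) a ` cube r)"
proof -
  have op: "open ((+) a ` cube r)" for a :: "real^'d"
    unfolding cube_eq_box by (intro open_translation open_box)
  have "closure A \<subseteq> (\<Union>a. (+) a ` cube r)"
  proof
    fix x :: "real^'d"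
    have "x \<in> (+) x ` cube r" using assms(1) by (intro image_eqI[of _ _ 0]) (auto simp: cube_def)
    then show "x \<in> (\<Union>a. (+) a ` cube r)" by blast
  qed
  moreover have "compact (closure A)" using assms(2) by (simp add: compact_closure)
  ultimately obtain C where "finite C" "closure A \<subseteq> (\<Union>a\<in>C. (+) a ` cube r)"
    using compactE_image[of "closure A" UNIV "\<lambda>a. (+) a ` cube r"] op by metis
  then show ?thesis using closure_subset[of A] by blast
qed

lemma cube_borel: "(+) a ` cube r \<in> sets (borel :: (real^'d) measure)"
proof -
  have "(+) a ` cube r = (\<lambda>x. x - a) -` cube r"
    by (auto intro: image_eqI[of _ _ "_ - a"])
  moreover have "cube r \<in> sets (borel :: (real^'d) measure)" unfolding cube_def by measurable
  ultimately show ?thesis using measurable_sets_borel[of "\<lambda>x. x - a" borel "cube r"] by simp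
qed

section \<open>Atoms of a uniformly discrete measure\<close>

locale uniformly_discrete_measure =
  fixes m :: nat and r :: real and lam :: "((real^'d) \<times> nat) measure"
  assumes r: "r > 0" and ud: "lam \<in> Mp_ud m r"
begin

lemma Mp: "lam \<in> Mp m"
  using ud by (simp add: Mp_ud_def)

lemma points_subset: "points lam \<subseteq> colour_space m"
  using Mp by (auto simp: points_def Mp_space)

definition window :: "real^'d \<Rightarrow> ((real^'d) \<times> nat) set" where
  "window a = (+) a ` cube r \<times> {1..m}"

lemma window_sets: "window a \<in> sets lam"
  using Mp by (auto simp: Mp_sets_iff window_def colour_space_def cube_borel intro!: borel_Times)

lemma emeasure_window: "emeasure lam (window a) \<le> 1"
  using ud by (simp add: Mp_ud_def window_def)

lemma in_window: "p \<in> colour_space m \<Longrightarrow> p \<in> window (fst p)"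
  using r by (auto simp: window_def colour_space_def mem_Times_iff cube_def intro!: image_eqI[of _ _ 0])

lemma Mp_nat: "A \<in> sets lam \<Longrightarrow> bounded (fst ` A) \<Longrightarrow> emeasure lam A \<in> \<nat>"
  using Mp_emeasure_bounded(2)[OF Mp] Mp_sets_iff[OF Mp] by blast

lemma ennreal_Nats_less_one: "(x::ennreal) \<in> \<nat> \<Longrightarrow> x < 1 \<Longrightarrow> x = 0"
proof (elim Nats_cases)
  fix n assume "x < 1" "x = of_nat n"
  then show "x = 0" by (cases n) (auto simp: not_less)
qed

text \<open>The cube around \<open>p\<close> has mass at most 1 and masses of bounded sets are
  integers, so a positive point mass can only be 1.\<close>

lemma emeasure_point:
  assumes p: "p \<in> points lam" shows "emeasure lam {p} = 1"
proof (rule ccontr)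
  assume ne: "emeasure lam {p} \<noteq> 1"
  have pc: "p \<in> colour_space m" using p points_subset by blast
  have "emeasure lam {p} \<le> emeasure lam (window (fst p))"
    using in_window[OF pc] by (intro emeasure_mono window_sets) auto
  then have "emeasure lam {p} < 1" using emeasure_window[of "fst p"] ne by (auto simp: less_le)
  then have "emeasure lam {p} = 0"
    using Mp_nat[OF singleton_sets[OF Mp pc]] by (intro ennreal_Nats_less_one) auto
  then show False using p by (simp add: points_def)
qed

lemma points_in_window_unique:
  assumes "p \<in> points lam" "q \<in> points lam" "p \<in> window a" "q \<in> window a"
  shows "p = q"
proof (rule ccontr)
  assume "p \<noteq> q"
  have pq: "{p} \<in> sets lam" "{q} \<in> sets lam"
    using assms points_subset by (auto intro: singleton_sets[OF Mp])
  have "emeasure lam {p, q} = emeasure lam ({p} \<union> {q})" by (simp add: insert_commute)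
  also have "\<dots> = 2"
    using \<open>p \<noteq> q\<close> pq assms by (subst plus_emeasure[symmetric]) (auto simp: emeasure_point)
  finally have "2 \<le> emeasure lam (window a)"
    using emeasure_mono[of "{p, q}" "window a" lam] assms window_sets by auto
  also have "\<dots> \<le> 1" by (rule emeasure_window)
  finally show False by simp
qed

text \<open>A \<open>window\<close> contains all colours, so two colours cannot sit at one location.
  Points may therefore be counted through their projections to space.\<close>

lemma inj_on_fst_points: "inj_on fst (points lam)"
proof (rule inj_onI)
  fix p q assume pq: "p \<in> points lam" "q \<in> points lam" "fst p = fst q"
  have "p \<in> window (fst p)" "q \<in> window (fst p)"
    using pq in_window[of p] in_window[of q] points_subset by auto
  then show "p = q" using points_in_window_unique pq by blast
qed

lemma points_covered:
  assumes "finite C" "A \<subseteq> (\<Union>a\<in>C. (+) a ` cube r)"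
  shows "finite (points lam \<inter> A \<times> UNIV)" "card (points lam \<inter> A \<times> UNIV) \<le> card C"
proof -
  have "\<forall>p\<in>points lam \<inter> A \<times> UNIV. \<exists>a\<in>C. p \<in> window a"
    using assms(2) points_subset by (fastforce simp: window_def colour_space_def)
  then obtain c where c: "\<And>p. p \<in> points lam \<inter> A \<times> UNIV \<Longrightarrow> c p \<in> C \<and> p \<in> window (c p)"
    by metis
  have inj: "inj_on c (points lam \<inter> A \<times> UNIV)"
    using c points_in_window_unique by (intro inj_onI) (metis Int_iff)
  have sub: "c ` (points lam \<inter> A \<times> UNIV) \<subseteq> C" using c by blast
  show "finite (points lam \<inter> A \<times> UNIV)" using inj sub assms(1) by (metis finite_imageD finite_subset)
  show "card (points lam \<inter> A \<times> UNIV) \<le> card C" using card_inj_on_le[OF inj sub assms(1)] .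
qed

lemma countable_points: "countable (points lam)"
proof -
  have "finite (points lam \<inter> cball 0 (real n) \<times> UNIV)" for n
    using bounded_finite_cube_cover[OF r bounded_cball[of "0::real^'d" "real n"]] points_covered(1) by blast
  then have "countable (\<Union>n. points lam \<inter> cball 0 (real n) \<times> UNIV)"
    by (intro countable_UN) (auto intro: countable_finite)
  moreover have "points lam \<subseteq> (\<Union>n. points lam \<inter> cball 0 (real n) \<times> UNIV)"
    by (auto intro: real_arch_simple)
  ultimately show ?thesis by (rule countable_subset[rotated])
qed

text \<open>Balls in the colour of \<open>p\<close> shrink to \<open>{p}\<close>, so their masses
  tend to the mass of \<open>p\<close>, which is 0. A sequence of integers tending to 0 contains
  0.\<close>

lemma null_neighbourhood:
  assumes p: "p \<in> colour_space m" "p \<notin> points lam"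
  shows "\<exists>U. open U \<and> p \<in> U \<and> emeasure lam (U \<inter> colour_space m) = 0"
proof -
  define B where "B n = ball (fst p) (inverse (real (Suc n))) \<times> {snd p}" for n
  have i: "snd p \<in> {1..m}" using p by (auto simp: colour_space_def)
  have op: "open (B n)" for n
    unfolding B_def by (intro open_Times open_ball discrete_topology_class.open_discrete)
  have sub: "B n \<subseteq> colour_space m" for n using i by (auto simp: B_def colour_space_def)
  have sets: "B n \<in> sets lam" for n using op sub Mp by (simp add: Mp_sets_iff)
  have bd: "bounded (fst ` B n)" for n by (auto simp: B_def intro: bounded_subset[OF bounded_ball])
  have fin: "emeasure lam (B n) \<noteq> \<infinity>" for n
    using Mp_emeasure_bounded(1)[OF Mp _ sub bd, of n] op[of n] by (simp add: less_top)
  have dec: "decseq B"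
    unfolding decseq_def B_def
    by (intro allI impI Sigma_mono subset_ball) (auto intro: le_imp_inverse_le)
  have "(\<Inter>n. B n) = {p}"
  proof (intro equalityI subsetI)
    fix q assume q: "q \<in> (\<Inter>n. B n)"
    have "dist (fst p) (fst q) \<le> 0"
    proof (rule ccontr)
      assume "\<not> dist (fst p) (fst q) \<le> 0"
      then obtain n where "inverse (real (Suc n)) < dist (fst p) (fst q)"
        using reals_Archimedean[of "dist (fst p) (fst q)"] by auto
      moreover have "q \<in> B n" using q by blast
      ultimately show False by (auto simp: B_def mem_Times_iff)
    qed
    moreover have "snd q = snd p" using q by (auto simp: B_def)
    ultimately show "q \<in> {p}" by (simp add: prod_eq_iff)
  qed (auto simp: B_def mem_Times_iff)
  then have "(\<lambda>n. emeasure lam (B n)) \<longlonglongrightarrow> emeasure lam {p}"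
    using Lim_emeasure_decseq[of B lam] sets dec fin by auto
  moreover have "emeasure lam {p} = 0" using p Mp by (simp add: points_def Mp_space)
  ultimately have "\<forall>\<^sub>F n in sequentially. emeasure lam (B n) < 1"
    by (simp add: order_tendstoD)
  then obtain n where "emeasure lam (B n) < 1" by (auto simp: eventually_sequentially)
  then have "emeasure lam (B n) = 0" by (intro ennreal_Nats_less_one Mp_nat sets bd)
  moreover have "B n \<inter> colour_space m = B n" using sub by blast
  ultimately show ?thesis using op by (intro exI[of _ "B n"]) (auto simp: B_def mem_Times_iff)
qed

text \<open>Every non-atom has a null neighbourhood because the masses are integers; the Lindelof property
  turns these into one null set.\<close>

lemma null_complement: "colour_space m - points lam \<in> null_sets lam"
proof -
  define \<U> where "\<U> = {U. open U \<and> emeasure lam (U \<inter> colour_space m) = 0}"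
  obtain \<V> where V: "\<V> \<subseteq> \<U>" "countable \<V>" "\<Union>\<V> = \<Union>\<U>"
    using Lindelof[of \<U>] by (auto simp: \<U>_def)
  have null: "U \<inter> colour_space m \<in> null_sets lam" if "U \<in> \<V>" for U
    using that V(1) Mp by (auto simp: \<U>_def null_sets_def Mp_sets_iff)
  have eq: "colour_space m - points lam = (\<Union>U\<in>\<V>. U \<inter> colour_space m)"
  proof (intro equalityI subsetI)
    fix p assume "p \<in> colour_space m - points lam"
    then obtain U where "open U" "p \<in> U" "emeasure lam (U \<inter> colour_space m) = 0"
      using null_neighbourhood[of p] by auto
    then have "p \<in> \<Union>\<U>" by (auto simp: \<U>_def)
    then show "p \<in> (\<Union>U\<in>\<V>. U \<inter> colour_space m)"
      using V(3) \<open>p \<in> colour_space m - points lam\<close> by blast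
  next
    fix p assume "p \<in> (\<Union>U\<in>\<V>. U \<inter> colour_space m)"
    then obtain U where U: "U \<in> \<V>" "p \<in> U" "p \<in> colour_space m" by blast
    have "emeasure lam {p} \<le> emeasure lam (U \<inter> colour_space m)"
      using U null by (intro emeasure_mono) auto
    also have "\<dots> = 0" using null[OF U(1)] by auto
    finally show "p \<in> colour_space m - points lam" using U by (auto simp: points_def)
  qed
  show ?thesis unfolding eq using V(2) null by (intro null_sets_UN') auto
qed

text \<open>Off the points the measure vanishes, and each of the countably many points has mass 1.
  This justifies working with \<open>points lam\<close> in place of \<open>lam\<close>.\<close>

lemma emeasure_eq_card_points:
  assumes A: "A \<in> sets lam"
  shows "emeasure lam A = emeasure (count_space UNIV) (A \<inter> points lam)"
proof -
  have Ac: "A \<subseteq> colour_space m" using A Mp by (simp add: Mp_sets_iff)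
  have AP: "A \<inter> points lam = A - (colour_space m - points lam)" using Ac by blast
  have "emeasure lam A = emeasure lam (A \<inter> points lam)"
    unfolding AP using null_complement A by (simp add: emeasure_Diff_null_set)
  also have "\<dots> = (\<integral>\<^sup>+p. emeasure lam {p} \<partial>count_space (A \<inter> points lam))"
    using countable_points points_subset Mp
    by (intro emeasure_countable_singleton) (auto intro: singleton_sets)
  also have "\<dots> = (\<integral>\<^sup>+p. 1 \<partial>count_space (A \<inter> points lam))"
    by (intro nn_integral_cong) (auto simp: emeasure_point)
  also have "\<dots> = emeasure (count_space UNIV) (A \<inter> points lam)"
    by (simp add: emeasure_count_space)
  finally show ?thesis .
qed

end

section \<open>Uniform counts and measurable sums over finite sets\<close>

lemma finite_points:
  fixes A :: "(real^'d) set"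
  assumes "r > 0" "bounded A"
  shows "\<exists>K. \<forall>lam\<in>Mp_ud m r. finite (points lam \<inter> A \<times> UNIV) \<and> card (points lam \<inter> A \<times> UNIV) \<le> K"
proof -
  obtain C where C: "finite C" "A \<subseteq> (\<Union>a\<in>C. (+) a ` cube r)"
    using bounded_finite_cube_cover[OF assms] by blast
  have "finite (points lam \<inter> A \<times> UNIV) \<and> card (points lam \<inter> A \<times> UNIV) \<le> card C"
    if "lam \<in> Mp_ud m r" for lam
  proof -
    interpret uniformly_discrete_measure m r lam using assms(1) that by unfold_locales
    show ?thesis using points_covered[OF C] by blast
  qed
  then show ?thesis by blast
qed

text \<open>Up to normalisation, counting measure on \<open>P x\<close> is a subprobability kernel,
  measurable in \<open>x\<close> because the counts are. The sum is an integral against this kernel,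
  with an integrand that may itself depend on \<open>x\<close>.\<close>

lemma sum_over_finite_sets_measurable:
  fixes P :: "'a \<Rightarrow> 'b::topological_space set" and h :: "'a \<times> 'b \<Rightarrow> ennreal"
  assumes fin: "\<And>x. x \<in> space M \<Longrightarrow> finite (P x) \<and> card (P x) \<le> K"
    and meas: "\<And>A. A \<in> sets borel \<Longrightarrow> (\<lambda>x. of_nat (card (P x \<inter> A)) :: ennreal) \<in> borel_measurable M"
    and h[measurable]: "h \<in> borel_measurable (M \<Otimes>\<^sub>M borel)"
  shows "(\<lambda>x. \<Sum>y\<in>P x. h (x, y)) \<in> borel_measurable M"
proof -
  \<comment> \<open>Dividing by \<open>Suc K\<close> keeps the total mass at most 1 and avoids a
    zero divisor for \<open>K = 0\<close>.\<close>
  define c :: ennreal where "c = ennreal (1 / real (Suc K))"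
  have c: "of_nat (Suc K) * c = 1"
    unfolding c_def ennreal_of_nat_eq_real_of_nat
    by (subst ennreal_mult[symmetric]) (simp_all del: of_nat_Suc)
  \<comment> \<open>Pushing forward to \<open>borel\<close> puts the measures on one common space
    although the sets \<open>P x\<close> vary.\<close>
  define L where "L x = scale_measure c (distr (count_space (P x)) (borel :: 'b measure) (\<lambda>y. y))" for x
  have sets_L: "sets (L x) = sets borel" for x by (simp add: L_def)
  have em: "emeasure (L x) A = c * of_nat (card (P x \<inter> A))" if x: "x \<in> space M" and A: "A \<in> sets borel" for x A
  proof -
    have "emeasure (distr (count_space (P x)) (borel :: 'b measure) (\<lambda>y. y)) A = emeasure (count_space (P x)) (P x \<inter> A)"
      using A by (subst emeasure_distr) (auto simp: Int_commute)
    also have "\<dots> = of_nat (card (P x \<inter> A))"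
      using fin[OF x] by (intro emeasure_count_space_finite) auto
    finally show ?thesis by (simp add: L_def)
  qed
  have [measurable]: "L \<in> measurable M (subprob_algebra borel)"
  proof (rule measurable_subprob_algebra)
    fix x assume x: "x \<in> space M"
    show "subprob_space (L x)"
    proof
      have "emeasure (L x) (space (L x)) = c * of_nat (card (P x))"
        using em[OF x, of UNIV] by (simp add: L_def space_scale_measure)
      also have "\<dots> \<le> c * of_nat (Suc K)"
        using fin[OF x] by (intro mult_left_mono) (auto simp del: of_nat_Suc)
      also have "\<dots> = 1"
        by (simp only: mult.commute[of c] c)
      finally show "emeasure (L x) (space (L x)) \<le> 1" .
      show "space (L x) \<noteq> {}" by (simp add: L_def space_scale_measure)
    qed
    show "sets (L x) = sets borel" by (rule sets_L)
  next
    fix A :: "'b set" assume A: "A \<in> sets borel"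
    have "(\<lambda>x. c * of_nat (card (P x \<inter> A))) \<in> borel_measurable M" using meas[OF A] by measurable
    then show "(\<lambda>x. emeasure (L x) A) \<in> borel_measurable M"
      using em A by (subst measurable_cong) auto
  qed
  have "(\<lambda>x. \<integral>\<^sup>+y. h (x, y) \<partial>L x) \<in> borel_measurable M"
    by (rule nn_integral_measurable_subprob_algebra2[where N=borel]) measurable
  then have "(\<lambda>x. of_nat (Suc K) * (\<integral>\<^sup>+y. h (x, y) \<partial>L x)) \<in> borel_measurable M"
    by measurable
  moreover have "of_nat (Suc K) * (\<integral>\<^sup>+y. h (x, y) \<partial>L x) = (\<Sum>y\<in>P x. h (x, y))" if x: "x \<in> space M" for x
  proof -
    have [measurable]: "(\<lambda>y. h (x, y)) \<in> borel_measurable borel"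
      using x by measurable
    have "(\<integral>\<^sup>+y. h (x, y) \<partial>L x) = c * (\<integral>\<^sup>+y. h (x, y) \<partial>distr (count_space (P x)) (borel :: 'b measure) (\<lambda>y. y))"
      unfolding L_def by (rule nn_integral_scale_measure) simp
    also have "(\<integral>\<^sup>+y. h (x, y) \<partial>distr (count_space (P x)) (borel :: 'b measure) (\<lambda>y. y)) = (\<integral>\<^sup>+y. h (x, y) \<partial>count_space (P x))"
      by (rule nn_integral_distr) auto
    also have "\<dots> = (\<Sum>y\<in>P x. h (x, y))"
      using fin[OF x] by (intro nn_integral_count_space_finite) auto
    finally show ?thesis
      by (simp only: mult.assoc[symmetric] c mult_1)
  qed
  ultimately show ?thesis by (subst (asm) measurable_cong) auto
qed

section \<open>Occurrences of a pattern\<close>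

text \<open>The condition of \<open>pattern_count\<close> involving the observation set is left out,
  which makes this set equivariant under translations.\<close>

definition occurrences ::
  "((real^'d) \<times> nat) set \<Rightarrow> (real^'d) set \<Rightarrow> ((real^'d) \<times> nat) set \<Rightarrow> (real^'d) set" where
  "occurrences F V Lam = {x \<in> down Lam. F \<subseteq> set_shift ((\<lambda>v. - x + v) ` V) Lam}"

lemma mem_set_shift_iff:
  "q \<in> set_shift ((\<lambda>v. - x + v) ` V) Lam \<longleftrightarrow> (\<exists>p\<in>Lam. snd p = snd q \<and> x + fst q - fst p \<in> V)"
proof
  assume "q \<in> set_shift ((\<lambda>v. - x + v) ` V) Lam"
  then obtain v p where "v \<in> V" "p \<in> Lam" "q = shift (- x + v) p"
    by (auto simp: set_shift_def)
  then show "\<exists>p\<in>Lam. snd p = snd q \<and> x + fst q - fst p \<in> V"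
    by (intro bexI[of _ p]) (auto simp: algebra_simps)
next
  assume "\<exists>p\<in>Lam. snd p = snd q \<and> x + fst q - fst p \<in> V"
  then obtain p where p: "p \<in> Lam" "snd p = snd q" "x + fst q - fst p \<in> V" by blast
  have "q = shift (- x + (x + fst q - fst p)) p" using p by (simp add: shift_def prod_eq_iff)
  then show "q \<in> set_shift ((\<lambda>v. - x + v) ` V) Lam"
    using p unfolding set_shift_def by blast
qed

lemma mem_occurrences_iff:
  "x \<in> occurrences F V Lam \<longleftrightarrow>
    x \<in> down Lam \<and> (\<forall>q\<in>F. \<exists>p\<in>Lam. snd p = snd q \<and> x + fst q - fst p \<in> V)"
  unfolding occurrences_def mem_Collect_eq subset_eq mem_set_shift_iff ..

lemma down_eq: "down Lam = fst ` Lam"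
  by (force simp: down_def)

lemma occurrences_translate: "occurrences F V (shift t ` Lam) = (+) t ` occurrences F V Lam"
proof -
  have "x \<in> occurrences F V (shift t ` Lam) \<longleftrightarrow> x - t \<in> occurrences F V Lam" for x
  proof -
    have "x \<in> down (shift t ` Lam) \<longleftrightarrow> x - t \<in> down Lam"
      unfolding down_eq by (force simp: image_iff algebra_simps)
    then show ?thesis
      unfolding mem_occurrences_iff by (simp add: algebra_simps)
  qed
  then have "occurrences F V (shift t ` Lam) = (\<lambda>x. x - t) -` occurrences F V Lam" by blast
  also have "\<dots> = (+) t ` occurrences F V Lam"
    by (auto intro: image_eqI[of _ _ "_ - t"])
  finally show ?thesis .
qed

lemma set_shift_translate:
  "F \<subseteq> set_shift V (shift (- x) ` Lam) \<longleftrightarrow> F \<subseteq> set_shift ((\<lambda>v. - x + v) ` V) Lam"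
proof -
  have "set_shift V (shift (- x) ` Lam) = set_shift ((\<lambda>v. - x + v) ` V) Lam"
    by (simp add: set_shift_def image_image add.commute)
  then show ?thesis by simp
qed

lemma fst_borel_measurable [measurable]:
  "(fst :: (real^'d) \<times> nat \<Rightarrow> real^'d) \<in> borel_measurable borel"
  and snd_borel_measurable [measurable]:
  "(snd :: (real^'d) \<times> nat \<Rightarrow> nat) \<in> borel_measurable borel"
  by (intro borel_measurable_continuous_onI continuous_intros)+

text \<open>Occurrences are counted by finite sums over the points in one large window: an outer sum
  over candidate points and, for each element of \<open>F\<close>, an inner sum over its possible
  partners. Both are covered by \<open>sum_over_finite_sets_measurable\<close>, the inner one with
  the location as an extra parameter.\<close>

lemma occurrences_count_measurable:
  fixes F :: "((real^'d) \<times> nat) set" and V A :: "(real^'d) set"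
  assumes r: "r > 0" and ud: "space M \<subseteq> Mp_ud m r"
    and em: "\<And>A n. A \<in> sets borel \<Longrightarrow>
        (\<lambda>lam. emeasure lam (A \<inter> ball 0 (real n) \<times> {1..m})) \<in> borel_measurable M"
    and F: "finite F" and V[measurable]: "V \<in> sets borel" and bdV: "bounded V"
    and A[measurable]: "A \<in> sets borel" and bdA: "bounded A"
  shows "(\<lambda>lam. real (card (occurrences F V (points lam) \<inter> A))) \<in> borel_measurable M"
proof -
  obtain a where a: "\<And>x. x \<in> A \<Longrightarrow> norm x \<le> a" using bdA by (auto simp: bounded_iff)
  obtain b where b: "\<And>v. v \<in> V \<Longrightarrow> norm v \<le> b" using bdV by (auto simp: bounded_iff)
  obtain c where c: "\<And>q. q \<in> F \<Longrightarrow> norm (fst q) \<le> c"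
    using finite_imp_bounded[OF finite_imageI[OF F, of fst]] unfolding bounded_iff by blast
  \<comment> \<open>Exceeding \<open>a\<close>, the radius covers all candidates in
    \<open>A\<close>; exceeding \<open>a + c + b\<close>, it covers every partner
    \<open>x + fst q - v\<close> of an element of \<open>F\<close>.\<close>
  obtain n :: nat where n: "max a (a + c + b) < real n" using reals_Archimedean2 by blast
  define W where "W = ball (0::real^'d) (real n) \<times> {1..m}"
  define P where "P lam = points lam \<inter> W" for lam
  from finite_points[OF r bounded_ball[of "0::real^'d" "real n"], of m]
  obtain K where K: "\<forall>lam\<in>Mp_ud m r. finite (points lam \<inter> ball (0::real^'d) (real n) \<times> UNIV)
      \<and> card (points lam \<inter> ball (0::real^'d) (real n) \<times> UNIV) \<le> K"
    by (rule exE)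
  have finP: "finite (P lam)" "card (P lam) \<le> K" if "lam \<in> Mp_ud m r" for lam
  proof -
    have sub: "P lam \<subseteq> points lam \<inter> ball 0 (real n) \<times> UNIV" by (auto simp: P_def W_def)
    have fin: "finite (points lam \<inter> ball 0 (real n) \<times> UNIV)"
      and card: "card (points lam \<inter> ball 0 (real n) \<times> UNIV) \<le> K"
      using bspec[OF K that] by simp_all
    show "finite (P lam)" by (rule finite_subset[OF sub fin])
    show "card (P lam) \<le> K" by (rule order_trans[OF card_mono[OF fin sub] card])
  qed
  have countP: "(\<lambda>lam. of_nat (card (P lam \<inter> D)) :: ennreal) \<in> borel_measurable M" if D: "D \<in> sets borel" for D
  proof (subst measurable_cong)
    show "(\<lambda>lam. emeasure lam (D \<inter> W)) \<in> borel_measurable M" unfolding W_def by (rule em[OF D])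
    fix lam assume "lam \<in> space M"
    then have lam: "lam \<in> Mp_ud m r" using ud by blast
    interpret uniformly_discrete_measure m r lam using r lam by unfold_locales
    have "D \<inter> W \<in> sets lam"
      using D Mp by (auto simp: Mp_sets_iff W_def colour_space_def intro!: sets.Int borel_Times)
    then have "emeasure lam (D \<inter> W) = emeasure (count_space UNIV) (D \<inter> W \<inter> points lam)"
      by (rule emeasure_eq_card_points)
    also have "D \<inter> W \<inter> points lam = P lam \<inter> D" by (auto simp: P_def)
    also have "emeasure (count_space UNIV) (P lam \<inter> D) = of_nat (card (P lam \<inter> D))"
      using finP(1)[OF lam] by (intro emeasure_count_space_finite) auto
    finally show "of_nat (card (P lam \<inter> D)) = emeasure lam (D \<inter> W)" by simp
  qed
  \<comment> \<open>\<open>g q (lam, x)\<close> is the number of points in the window that can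
    represent \<open>q\<close> when the pattern is placed at \<open>x\<close>.\<close>
  define g :: "_ \<Rightarrow> ((real^'d) \<times> nat) measure \<times> (real^'d) \<Rightarrow> ennreal" where
    "g q z = (\<Sum>p\<in>P (fst z). indicator V (snd z + fst q - fst p) * indicator {snd q} (snd p))" for q z
  have g[measurable]: "g q \<in> borel_measurable (M \<Otimes>\<^sub>M borel)" for q
  proof -
    let ?h = "\<lambda>w :: (((real^'d) \<times> nat) measure \<times> (real^'d)) \<times> ((real^'d) \<times> nat).
      indicator V (snd (fst w) + fst q - fst (snd w)) * indicator {snd q} (snd (snd w)) :: ennreal"
    have "(\<lambda>z. \<Sum>p\<in>P (fst z). ?h (z, p)) \<in> borel_measurable (M \<Otimes>\<^sub>M borel)"
    proof (rule sum_over_finite_sets_measurable)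
      show "finite (P (fst z)) \<and> card (P (fst z)) \<le> K" if "z \<in> space (M \<Otimes>\<^sub>M (borel :: (real^'d) measure))" for z
        using that finP[of "fst z"] ud by (auto simp: space_pair_measure)
      show "(\<lambda>z. of_nat (card (P (fst z) \<inter> D)) :: ennreal)
          \<in> borel_measurable (M \<Otimes>\<^sub>M (borel :: (real^'d) measure))"
        if "D \<in> sets borel" for D
        by (rule measurable_compose[OF measurable_fst countP[OF that]])
      show "?h \<in> borel_measurable ((M \<Otimes>\<^sub>M borel) \<Otimes>\<^sub>M borel)" by measurable
    qed
    then show ?thesis unfolding g_def by simp
  qed
  have g_pos: "0 < g q (lam, x) \<longleftrightarrow> (\<exists>p\<in>points lam. snd p = snd q \<and> x + fst q - fst p \<in> V)"
    if lam: "lam \<in> Mp_ud m r" and x: "x \<in> A" and q: "q \<in> F" for q lam x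
  proof -
    have inW: "p \<in> W" if p: "p \<in> points lam" "x + fst q - fst p \<in> V" for p
    proof -
      interpret uniformly_discrete_measure m r lam using r lam by unfold_locales
      have "norm (fst p) = norm (x + fst q - (x + fst q - fst p))" by simp
      also have "\<dots> \<le> norm x + norm (fst q) + norm (x + fst q - fst p)"
        by (intro order_trans[OF norm_triangle_ineq4] add_right_mono norm_triangle_ineq)
      also have "\<dots> \<le> a + c + b" by (intro add_mono a b c x q p)
      also have "\<dots> < real n" using n by simp
      finally show ?thesis using p points_subset by (auto simp: W_def colour_space_def mem_Times_iff)
    qed
    have "0 < g q (lam, x) \<longleftrightarrow> g q (lam, x) \<noteq> 0" by (simp add: zero_less_iff_neq_zero)
    also have "\<dots> \<longleftrightarrow> (\<exists>p\<in>P lam. indicator V (x + fst q - fst p) * indicator {snd q} (snd p) \<noteq> (0::ennreal))"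
      unfolding g_def using finP(1)[OF lam] by (subst sum_eq_0_iff) auto
    also have "\<dots> \<longleftrightarrow> (\<exists>p\<in>P lam. snd p = snd q \<and> x + fst q - fst p \<in> V)"
      by (auto simp: indicator_def)
    also have "\<dots> \<longleftrightarrow> (\<exists>p\<in>points lam. snd p = snd q \<and> x + fst q - fst p \<in> V)"
      using inW by (auto simp: P_def)
    finally show ?thesis .
  qed
  \<comment> \<open>The quantifier over the finite set \<open>F\<close> becomes a product of
    indicators of positive partner numbers.\<close>
  define h :: "((real^'d) \<times> nat) measure \<times> ((real^'d) \<times> nat) \<Rightarrow> ennreal" where
    "h w = indicator A (fst (snd w)) * (\<Prod>q\<in>F. indicator {0<..} (g q (fst w, fst (snd w))))" for w
  have h[measurable]: "h \<in> borel_measurable (M \<Otimes>\<^sub>M borel)" unfolding h_def by measurable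
  have "(\<lambda>lam. \<Sum>p\<in>P lam. h (lam, p)) \<in> borel_measurable M"
    using finP ud countP by (intro sum_over_finite_sets_measurable[where K=K]) auto
  then have "(\<lambda>lam. enn2real (\<Sum>p\<in>P lam. h (lam, p))) \<in> borel_measurable M" by measurable
  moreover have "enn2real (\<Sum>p\<in>P lam. h (lam, p)) = real (card (occurrences F V (points lam) \<inter> A))"
    if "lam \<in> space M" for lam
  proof -
    have lam: "lam \<in> Mp_ud m r" using that ud by blast
    interpret uniformly_discrete_measure m r lam using r lam by unfold_locales
    let ?O = "occurrences F V (points lam) \<inter> A"
    have hp: "h (lam, p) = indicator ?O (fst p)" if p: "p \<in> P lam" for p
    proof (cases "fst p \<in> A")
      case True
      have "(\<Prod>q\<in>F. indicator {0<..} (g q (lam, fst p)) :: ennreal)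
          = of_bool (\<forall>q\<in>F. 0 < g q (lam, fst p))"
        using F by (induction F) (auto simp: indicator_def)
      also have "(\<forall>q\<in>F. 0 < g q (lam, fst p)) \<longleftrightarrow> fst p \<in> occurrences F V (points lam)"
        using g_pos[OF lam True] p unfolding mem_occurrences_iff down_eq by (auto simp: P_def)
      finally show ?thesis using True by (simp add: h_def indicator_def)
    qed (simp add: h_def)
    have sub: "?O \<subseteq> fst ` P lam"
    proof
      fix x assume x: "x \<in> ?O"
      then obtain p where p: "p \<in> points lam" "x = fst p" by (auto simp: mem_occurrences_iff down_eq)
      have "norm x < real n" using a[of x] x n by auto
      then have "p \<in> W" using p points_subset by (auto simp: W_def colour_space_def mem_Times_iff)
      then show "x \<in> fst ` P lam" using p by (auto simp: P_def)
    qed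
    have "inj_on fst (P lam)" using inj_on_fst_points by (rule inj_on_subset) (simp add: P_def)
    then have "(\<Sum>p\<in>P lam. h (lam, p)) = (\<Sum>x\<in>fst ` P lam. indicator ?O x)"
      by (simp add: sum.reindex hp)
    also have "\<dots> = (\<Sum>x\<in>fst ` P lam. if x \<in> ?O then 1 else 0)"
      by (intro sum.cong refl) (simp only: indicator_def of_bool_def)
    also have "\<dots> = (\<Sum>x\<in>fst ` P lam \<inter> ?O. 1)"
      by (rule sum.inter_restrict[symmetric]) (intro finite_imageI finP(1)[OF lam])
    also have "fst ` P lam \<inter> ?O = ?O" using sub by blast
    also have "(\<Sum>x\<in>?O. 1) = ennreal (real (card ?O))"
      by (simp only: sum_constant mult_1_right ennreal_of_nat_eq_real_of_nat)
    finally show ?thesis by (simp only: enn2real_ennreal of_nat_0_le_iff)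
  qed
  ultimately show ?thesis by (subst (asm) measurable_cong) auto
qed

section \<open>From the process to an ergodic point set\<close>

lemma emeasure_lborel_cube:
  assumes "R > 0"
  shows "emeasure lborel (cube R :: (real^'d) set) = ennreal (R ^ CARD('d))"
proof -
  let ?u = "(\<chi> i. R / 2) :: real^'d" and ?l = "(\<chi> i. - (R / 2)) :: real^'d"
  have b: "?u \<bullet> b = R / 2" "?l \<bullet> b = - (R / 2)" if "b \<in> Basis" for b
    using that by (auto simp: Basis_vec_def inner_axis)
  have "emeasure lborel (box ?l ?u) = ennreal (\<Prod>b\<in>Basis. (?u - ?l) \<bullet> b)"
    using assms by (intro emeasure_lborel_box) (simp add: b)
  also have "(\<Prod>b\<in>Basis. (?u - ?l) \<bullet> b) = (\<Prod>b\<in>(Basis :: (real^'d) set). R)"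
    by (intro prod.cong refl) (simp add: b inner_diff_left)
  also have "\<dots> = R ^ CARD('d)" by simp
  finally show ?thesis unfolding cube_eq_box .
qed

text \<open>The preimage of \<open>X\<close> under a translation is closed by continuity and of full
  measure by stationarity, so minimality of the support forces it to contain
  \<open>X\<close>.\<close>

lemma coloured_process_translate_support:
  fixes X :: "((real^'d) \<times> nat) measure set"
  assumes "coloured_ergodic_point_process m r X mu" and lam: "lam \<in> X"
  shows "translate t lam \<in> X"
proof -
  have space: "space mu = Mp m" and sets: "sets mu = sets (vague_borel m)"
    and stat: "stationary mu" and supp: "is_support m mu X"
    using assms(1) by (auto simp: coloured_ergodic_point_process_def)
  have X: "closedin (vague_topology m) X" using supp by (simp add: is_support_def)
  define C where "C = {nu \<in> Mp m. translate t nu \<in> X}"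
  have "closedin (vague_topology m) {nu \<in> topspace (vague_topology m). translate t nu \<in> X}"
    by (rule closedin_continuous_map_preimage[OF continuous_translate X])
  then have C: "closedin (vague_topology m) C" by (simp add: C_def topspace_vague_topology)
  have "Mp m - X \<in> sets mu"
    using closedin_vague_sets[OF X] sets.compl_sets[of X mu] by (simp add: sets space)
  with stat have "emeasure mu {nu \<in> space mu. translate t nu \<in> Mp m - X} = emeasure mu (Mp m - X)"
    unfolding stationary_def by blast
  moreover have "{nu \<in> space mu. translate t nu \<in> Mp m - X} = Mp m - C"
    using translate_in_Mp by (auto simp: space C_def)
  ultimately have "emeasure mu (Mp m - C) = 0" using supp by (simp add: is_support_def)
  then have "X \<subseteq> C" using supp C by (simp add: is_support_def)
  then show ?thesis using lam by (auto simp: C_def)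
qed

text \<open>The measure is restricted to \<open>X\<close> because uniform discreteness, and with it
  the bounded counts, is available there at every configuration. Invariance of \<open>X\<close> in
  both directions lets stationarity and ergodicity pass to the restriction.\<close>

lemma coloured_process_ergodic_point_set:
  fixes X :: "((real^'d) \<times> nat) measure set" and V :: "(real^'d) set"
  assumes r: "r > 0" and proc: "coloured_ergodic_point_process m r X mu"
    and F: "finite F" and V: "V \<in> sets borel" "bounded V"
  shows "ergodic_point_set (restrict_space mu X) translate (\<lambda>lam. occurrences F V (points lam))"
proof -
  have mu: "prob_space mu" and space: "space mu = Mp m" and sets: "sets mu = sets (vague_borel m)"
    and stat: "stationary mu" and erg: "ergodic mu" and supp: "is_support m mu X"
    and X_ud: "X \<subseteq> Mp_ud m r"
    using proc by (auto simp: coloured_ergodic_point_process_def)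
  interpret mu: prob_space mu by (rule mu)
  have X_Mp: "X \<subseteq> Mp m" using X_ud by (auto simp: Mp_ud_def)
  have X: "X \<in> sets mu"
    using supp closedin_vague_sets[of m X] by (simp add: is_support_def sets)
  note invariant = coloured_process_translate_support[OF proc]
  have preimage: "lam \<in> X" if "lam \<in> Mp m" "translate t lam \<in> X" for lam t
    using invariant[OF that(2), of "- t"] translate_translate[OF that(1), of "- t" t] translate_0[OF that(1)]
    by simp
  have "emeasure mu X = 1"
  proof -
    have "AE lam in mu. lam \<in> X"
      using X supp
      by (intro AE_I[of _ _ "Mp m - X"])
        (auto simp: space is_support_def intro: sets.compl_sets[of X mu, unfolded space])
    then have "emeasure mu X = emeasure mu (space mu)"
      using X AE_space[of mu] by (intro emeasure_eq_AE) auto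
    then show ?thesis by (simp add: mu.emeasure_space_1)
  qed
  then have prob: "prob_space (restrict_space mu X)" by (rule prob_space_restrict_space[OF X])
  have space_M: "space (restrict_space mu X) = X" using X_Mp by (auto simp: space_restrict_space space)
  have sets_M: "D \<in> sets (restrict_space mu X) \<longleftrightarrow> D \<in> sets mu \<and> D \<subseteq> X" for D
    using X by (auto simp: sets_restrict_space_iff)
  have T_mu: "translate t \<in> measurable mu mu" for t :: "real^'d"
    using translate_measurable[of t m] measurable_cong_sets[OF sets sets] by blast
  have T_M: "translate t \<in> measurable (restrict_space mu X) (restrict_space mu X)" for t :: "real^'d"
    by (rule measurable_restrict_space3[OF T_mu]) (use invariant in auto)
  show ?thesis
  proof (intro ergodic_point_set.intro stationary_point_set.intro prob
      stationary_point_set_axioms.intro ergodic_point_set_axioms.intro)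
    show "translate t \<in> measurable (restrict_space mu X) (restrict_space mu X)" for t :: "real^'d" by (rule T_M)
    show "distr (restrict_space mu X) (restrict_space mu X) (translate t) = restrict_space mu X" for t :: "real^'d"
    proof (rule measure_eqI)
      fix D assume "D \<in> sets (distr (restrict_space mu X) (restrict_space mu X) (translate t))"
      then have D: "D \<in> sets (restrict_space mu X)" by simp
      then have D': "D \<in> sets mu" "D \<subseteq> X" by (auto simp: sets_M)
      have eq: "translate t -` D \<inter> X = {lam \<in> space mu. translate t lam \<in> D}"
        using D'(2) preimage X_Mp by (auto simp: space)
      have "emeasure (distr (restrict_space mu X) (restrict_space mu X) (translate t)) D
          = emeasure (restrict_space mu X) (translate t -` D \<inter> X)"
        using D T_M by (simp add: emeasure_distr space_M)
      also have "\<dots> = emeasure mu {lam \<in> space mu. translate t lam \<in> D}"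
        unfolding eq[symmetric] using X by (intro emeasure_restrict_space) auto
      also have "\<dots> = emeasure mu D" using stat D'(1) by (simp add: stationary_def)
      also have "\<dots> = emeasure (restrict_space mu X) D"
        using X D'(2) by (intro emeasure_restrict_space[symmetric]) auto
      finally show "emeasure (distr (restrict_space mu X) (restrict_space mu X) (translate t)) D
          = emeasure (restrict_space mu X) D" .
    qed simp
    show "occurrences F V (points (translate t lam)) = (+) t ` occurrences F V (points lam)"
      if "lam \<in> space (restrict_space mu X)" for t lam
    proof -
      have "lam \<in> Mp m" using that X_Mp by (auto simp: space_M)
      then show ?thesis by (simp only: points_translate occurrences_translate)
    qed
    show "\<exists>K::nat. \<forall>lam\<in>space (restrict_space mu X).
        finite (occurrences F V (points lam) \<inter> A) \<and> card (occurrences F V (points lam) \<inter> A) \<le> K"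
      if A: "bounded A" for A
    proof -
      from finite_points[OF r A, of m] obtain K where K: "\<forall>lam\<in>Mp_ud m r.
        finite (points lam \<inter> A \<times> UNIV) \<and> card (points lam \<inter> A \<times> UNIV) \<le> K" by (rule exE)
      show ?thesis
      proof (intro exI ballI)
        fix lam assume "lam \<in> space (restrict_space mu X)"
        then have lam: "lam \<in> Mp_ud m r" using X_ud by (auto simp: space_M)
        have fin: "finite (points lam \<inter> A \<times> UNIV)" and card: "card (points lam \<inter> A \<times> UNIV) \<le> K"
          using bspec[OF K lam] by simp_all
        have sub: "occurrences F V (points lam) \<inter> A \<subseteq> fst ` (points lam \<inter> A \<times> UNIV)"
          by (force simp: occurrences_def down_def)
        show "finite (occurrences F V (points lam) \<inter> A) \<and> card (occurrences F V (points lam) \<inter> A) \<le> K"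
          using finite_subset[OF sub finite_imageI[OF fin]]
            card_mono[OF finite_imageI[OF fin] sub] card_image_le[OF fin, of fst] card
          by linarith
      qed
    qed
    show "(\<lambda>lam. real (card (occurrences F V (points lam) \<inter> A))) \<in> borel_measurable (restrict_space mu X)"
      if "bounded A" "A \<in> sets borel" for A
    proof (rule occurrences_count_measurable[OF r _ _ F V that(2,1)])
      show "space (restrict_space mu X) \<subseteq> Mp_ud m r" using X_ud by (simp add: space_M)
      fix D :: "((real^'d) \<times> nat) set" and n :: nat assume D: "D \<in> sets borel"
      let ?W = "ball (0::real^'d) (real n) \<times> {1..m}"
      have "open ?W" by (intro open_Times open_ball discrete_topology_class.open_discrete)
      then have "(\<lambda>lam. emeasure lam (D \<inter> ?W)) \<in> borel_measurable (vague_borel m)"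
        by (rule emeasure_window_measurable[OF D])
          (auto simp: colour_space_def intro: bounded_subset[OF bounded_ball[of "0::real^'d" "real n"]])
      then have "(\<lambda>lam. emeasure lam (D \<inter> ?W)) \<in> borel_measurable mu"
        using measurable_cong_sets[OF sets refl] by blast
      then show "(\<lambda>lam. emeasure lam (D \<inter> ?W)) \<in> borel_measurable (restrict_space mu X)"
        by (rule measurable_restrict_space1)
    qed
    show "measure (restrict_space mu X) D = 0 \<or> measure (restrict_space mu X) D = 1"
      if D: "D \<in> sets (restrict_space mu X)"
        and inv: "\<And>t lam. lam \<in> space (restrict_space mu X) \<Longrightarrow> translate t lam \<in> D \<longleftrightarrow> lam \<in> D" for D
    proof -
      have D': "D \<in> sets mu" "D \<subseteq> X" using D by (auto simp: sets_M)
      \<comment> \<open>\<open>inv\<close> speaks of \<open>X\<close> only, but a configuration with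
        a translate in \<open>D \<subseteq> X\<close> lies in \<open>X\<close> itself, so
        \<open>D\<close> is invariant in the whole space.\<close>
      have "{lam \<in> space mu. translate t lam \<in> D} = D" for t
      proof (intro equalityI subsetI)
        fix lam assume "lam \<in> {lam \<in> space mu. translate t lam \<in> D}"
        then have "lam \<in> X" "translate t lam \<in> D" using D'(2) preimage by (auto simp: space)
        then show "lam \<in> D" using inv by (simp add: space_M)
      next
        fix lam assume "lam \<in> D"
        then show "lam \<in> {lam \<in> space mu. translate t lam \<in> D}"
          using inv[of lam t] D'(2) X_Mp by (auto simp: space_M space)
      qed
      then have "emeasure mu D = 0 \<or> emeasure mu D = 1" using erg D'(1) by (simp add: ergodic_def)
      then have "measure mu D = 0 \<or> measure mu D = 1" by (simp add: mu.emeasure_eq_measure)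
      moreover have "measure (restrict_space mu X) D = measure mu D"
        using X D'(2) by (intro measure_restrict_space) auto
      ultimately show ?thesis by (simp only:)
    qed
  qed
qed

text \<open>Seen from one of its points \<open>x\<close>, the configuration stays in
  \<open>X\<close> and shows the pattern at the origin exactly when \<open>x\<close> is an
  occurrence. The inner sum of the Palm measure thus counts the occurrences in
  \<open>B\<close>.\<close>

lemma palm_eq_intensity:
  fixes X :: "((real^'d) \<times> nat) measure set" and V :: "(real^'d) set"
  assumes r: "r > 0" and proc: "coloured_ergodic_point_process m r X mu"
  shows "palm mu X B (pattern_set X F V)
    = (\<integral>\<^sup>+lam. emeasure (count_space UNIV) (occurrences F V (points lam) \<inter> B) \<partial>restrict_space mu X)
      / emeasure lborel B"
proof -
  have X_Mp: "X \<subseteq> Mp m" and X: "X \<in> sets mu"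
    using proc closedin_vague_sets[of m X]
    by (auto simp: coloured_ergodic_point_process_def is_support_def Mp_ud_def)
  have "(\<integral>\<^sup>+lam\<in>X. (\<integral>\<^sup>+x. indicator (pattern_set X F V) (translate (- x) lam)
        \<partial>count_space (B \<inter> down (points lam))) \<partial>mu)
      = (\<integral>\<^sup>+lam\<in>X. emeasure (count_space UNIV) (occurrences F V (points lam) \<inter> B) \<partial>mu)"
  proof (intro nn_integral_cong)
    fix lam
    show "(\<integral>\<^sup>+x. indicator (pattern_set X F V) (translate (- x) lam)
        \<partial>count_space (B \<inter> down (points lam))) * indicator X lam
      = emeasure (count_space UNIV) (occurrences F V (points lam) \<inter> B) * indicator X lam"
    proof (cases "lam \<in> X")
      case True
      have mem: "translate (- x) lam \<in> pattern_set X F V \<longleftrightarrow> F \<subseteq> set_shift ((\<lambda>v. - x + v) ` V) (points lam)" for x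
      proof -
        have "lam \<in> Mp m" using True X_Mp by blast
        then show ?thesis
          using coloured_process_translate_support[OF proc True, of "- x"]
          by (simp add: pattern_set_def points_translate set_shift_translate)
      qed
      have "(\<integral>\<^sup>+x. indicator (pattern_set X F V) (translate (- x) lam) \<partial>count_space (B \<inter> down (points lam)))
          = (\<integral>\<^sup>+x. indicator (occurrences F V (points lam) \<inter> B) x \<partial>count_space (B \<inter> down (points lam)))"
        by (intro nn_integral_cong) (auto simp: indicator_def mem occurrences_def)
      also have "\<dots> = emeasure (count_space (B \<inter> down (points lam))) (occurrences F V (points lam) \<inter> B)"
        by (intro nn_integral_indicator) (auto simp: occurrences_def)
      also have "\<dots> = emeasure (count_space UNIV) (occurrences F V (points lam) \<inter> B)"
      proof -
        have "occurrences F V (points lam) \<inter> B \<subseteq> B \<inter> down (points lam)" by (auto simp: occurrences_def)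
        then show ?thesis by (simp only: emeasure_count_space subset_UNIV)
      qed
      finally show ?thesis by simp
    qed simp
  qed
  also have "\<dots> = (\<integral>\<^sup>+lam. emeasure (count_space UNIV) (occurrences F V (points lam) \<inter> B) \<partial>restrict_space mu X)"
    using X by (intro nn_integral_restrict_space[symmetric]) simp
  finally show ?thesis unfolding palm_def by simp
qed

text \<open>Choose \<open>v = 0\<close> and \<open>f = 0\<close>. This gives the upper estimate of
  \<open>pattern_count\<close>.\<close>

lemma occurrence_subset_imp_mem:
  assumes "0 \<in> V" "0 \<in> down F" "{x - v + f |v f. v \<in> V \<and> f \<in> down F} \<subseteq> A"
  shows "x \<in> A"
proof -
  have "x - 0 + 0 \<in> {x - v + f |v f. v \<in> V \<and> f \<in> down F}" using assms(1,2) by blast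
  then have "x - 0 + 0 \<in> A" using assms(3) by blast
  then show ?thesis by simp
qed

lemma pattern_count_le:
  assumes "0 \<in> V" "0 \<in> down F" "finite (occurrences F V Lam \<inter> B)" "A \<subseteq> B"
  shows "pattern_count F V Lam A \<le> card (occurrences F V Lam \<inter> B)"
  unfolding pattern_count_def
proof (rule card_mono[OF assms(3)], rule subsetI, elim CollectE conjE)
  fix x
  assume "x \<in> down Lam" "F \<subseteq> set_shift ((\<lambda>v. - x + v) ` V) Lam"
    and sub: "{x - v + f |v f. v \<in> V \<and> f \<in> down F} \<subseteq> A"
  moreover have "x \<in> A" by (rule occurrence_subset_imp_mem[OF assms(1,2) sub])
  ultimately show "x \<in> occurrences F V Lam \<inter> B"
    using assms(4) unfolding occurrences_def by blast
qed

text \<open>Lower counterpart of \<open>pattern_count_le\<close>: the last hypothesis keeps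
  \<open>A\<close> away from the boundary of \<open>B\<close> by the extent of the pattern.\<close>

lemma le_pattern_count:
  assumes "0 \<in> V" "0 \<in> down F" "finite (occurrences F V Lam \<inter> B)"
    and sub: "\<And>x v f. x \<in> A \<Longrightarrow> v \<in> V \<Longrightarrow> f \<in> down F \<Longrightarrow> x - v + f \<in> B"
  shows "card (occurrences F V Lam \<inter> A) \<le> pattern_count F V Lam B"
  unfolding pattern_count_def
proof (rule card_mono)
  have "{x \<in> down Lam. F \<subseteq> set_shift ((\<lambda>v. - x + v) ` V) Lam \<and>
      {x - v + f |v f. v \<in> V \<and> f \<in> down F} \<subseteq> B} \<subseteq> occurrences F V Lam \<inter> B"
    unfolding occurrences_def using occurrence_subset_imp_mem[OF assms(1,2)] by blast
  then show "finite {x \<in> down Lam. F \<subseteq> set_shift ((\<lambda>v. - x + v) ` V) Lam \<and>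
      {x - v + f |v f. v \<in> V \<and> f \<in> down F} \<subseteq> B}"
    using assms(3) by (rule finite_subset)
  show "occurrences F V Lam \<inter> A \<subseteq> {x \<in> down Lam. F \<subseteq> set_shift ((\<lambda>v. - x + v) ` V) Lam \<and>
      {x - v + f |v f. v \<in> V \<and> f \<in> down F} \<subseteq> B}"
    using sub unfolding occurrences_def by blast
qed

lemma cube_subset_slab: "R \<le> 2 * real n \<Longrightarrow> cube R \<subseteq> slab UNIV n"
proof
  fix x :: "real^'d" assume R: "R \<le> 2 * real n" and x: "x \<in> cube R"
  have "\<bar>x $ i\<bar> < R / 2" for i using x by (simp add: cube_def)
  then have "- real n \<le> x $ i \<and> x $ i < real n" for i
    using R by (smt (verit) field_sum_of_halves)
  then show "x \<in> slab UNIV n" by (simp add: slab_def)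
qed

lemma slab_add_mem_cube:
  fixes x y :: "real^'d"
  assumes x: "x \<in> slab UNIV n" and y: "norm y < real p" and R: "2 * real (n + p) \<le> R"
  shows "x + y \<in> cube R"
proof -
  have "\<bar>(x + y) $ i\<bar> < R / 2" for i
  proof -
    have "- real n \<le> x $ i" "x $ i < real n" using x by (auto simp: slab_def)
    moreover have "\<bar>y $ i\<bar> < real p" using component_le_norm_cart[of y i] y by linarith
    moreover have "real n + real p \<le> R / 2" using R by simp
    ultimately show ?thesis unfolding vector_add_component by linarith
  qed
  then show ?thesis by (simp add: cube_def)
qed

section \<open>Convergence of the pattern frequencies to the Palm measure\<close>

theorem pattern_density:
  fixes F :: "((real^'d) \<times> nat) set" and V B :: "(real^'d) set"
  assumes r: "r > 0" and proc: "coloured_ergodic_point_process m r X mu"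
    and pat: "is_pattern m r F V"
    and B: "bounded B" "B \<in> sets borel" "emeasure lborel B > 0"
  shows "AE lam\<in>X in mu.
    ((\<lambda>R. of_nat (pattern_count F V (points lam) (cube R)) / emeasure lborel (cube R :: (real^'d) set))
      \<longlongrightarrow> palm mu X B (pattern_set X F V)) at_top"
proof -
  have F: "finite F" "0 \<in> down F" and V: "V \<in> sets borel" "bounded V" "0 \<in> V"
    using pat interior_subset[of V] by (auto simp: is_pattern_def)
  have X_Mp: "X \<subseteq> Mp m" and X: "X \<in> sets mu" and space: "space mu = Mp m"
    using proc closedin_vague_sets[of m X]
    by (auto simp: coloured_ergodic_point_process_def is_support_def Mp_ud_def)
  interpret E: ergodic_point_set "restrict_space mu X" translate "\<lambda>lam. occurrences F V (points lam)"
    by (rule coloured_process_ergodic_point_set[OF r proc F(1) V(1,2)])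
  have space_E: "space (restrict_space mu X) = X" using X_Mp by (auto simp: space_restrict_space space)
  define e where "e = E.expectation (E.N (slab {} 0))"
  \<comment> \<open>The volume of \<open>B\<close> cancels because it is positive and, by
    boundedness, finite.\<close>
  have palm: "palm mu X B (pattern_set X F V) = ennreal e"
  proof -
    have "palm mu X B (pattern_set X F V) = ennreal e * emeasure lborel B / emeasure lborel B"
      unfolding palm_eq_intensity[OF r proc] E.number_def[symmetric] E.expected_number[OF B(2)] e_def ..
    moreover have "emeasure lborel B < \<infinity>" by (rule emeasure_bounded_finite[OF B(1)])
    ultimately show ?thesis using B(3) by (simp add: ennreal_mult_divide_eq less_top)
  qed
  \<comment> \<open>\<open>p\<close> bounds the displacements \<open>f - v\<close> within the
    pattern and becomes the margin in \<open>E.cube_density\<close>.\<close>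
  obtain p :: nat where p: "\<And>v f. v \<in> V \<Longrightarrow> f \<in> down F \<Longrightarrow> norm (f - v) < real p"
  proof -
    obtain b where b: "\<And>v. v \<in> V \<Longrightarrow> norm v \<le> b" using V(2) by (auto simp: bounded_iff)
    obtain c where c: "\<And>f. f \<in> down F \<Longrightarrow> norm f \<le> c"
      using finite_imp_bounded[OF finite_imageI[OF F(1), of fst]] unfolding down_eq bounded_iff by blast
    obtain p :: nat where "c + b < real p" using reals_Archimedean2 by blast
    moreover have "norm (f - v) \<le> c + b" if "v \<in> V" "f \<in> down F" for v f
      using norm_triangle_ineq4[of f v] b[OF that(1)] c[OF that(2)] by linarith
    ultimately show ?thesis using that[of p] by (meson order_le_less_trans)
  qed
  have bounded_cube: "bounded (cube R :: (real^'d) set)" for R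
    unfolding cube_eq_box by (rule bounded_box)
  have "AE lam in restrict_space mu X.
      ((\<lambda>R. real (pattern_count F V (points lam) (cube R)) / R ^ CARD('d)) \<longlongrightarrow> e) at_top"
    unfolding e_def
  proof (rule E.cube_density[where p=p])
    fix lam and n :: nat and R :: real
    assume lam: "lam \<in> space (restrict_space mu X)"
    show "E.N (slab UNIV n) lam \<le> real (pattern_count F V (points lam) (cube R))"
      if R: "2 * real (n + p) \<le> R"
      unfolding E.N_def of_nat_le_iff
    proof (rule le_pattern_count[OF V(3) F(2) E.finite_S[OF bounded_cube lam]])
      fix x v f :: "real^'d" assume "x \<in> slab UNIV n" "v \<in> V" "f \<in> down F"
      then have "x + (f - v) \<in> cube R" using p R by (intro slab_add_mem_cube) auto
      then show "x - v + f \<in> cube R" by (simp add: algebra_simps)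
    qed
    show "real (pattern_count F V (points lam) (cube R)) \<le> E.N (slab UNIV n) lam"
      if R: "R \<le> 2 * real n"
      unfolding E.N_def of_nat_le_iff
      by (rule pattern_count_le[OF V(3) F(2) E.finite_S[OF slab_bounded lam] cube_subset_slab[OF R]])
  qed
  then have "AE lam\<in>X in mu.
      ((\<lambda>R. real (pattern_count F V (points lam) (cube R)) / R ^ CARD('d)) \<longlongrightarrow> e) at_top"
    using X by (subst (asm) AE_restrict_space_iff) auto
  then show ?thesis
  proof eventually_elim
    case (elim lam)
    show ?case
    proof
      assume "lam \<in> X"
      with elim have "((\<lambda>R. ennreal (real (pattern_count F V (points lam) (cube R)) / R ^ CARD('d))) \<longlongrightarrow> ennreal e) at_top"
        by (intro tendsto_ennrealI) auto
      moreover have "\<forall>\<^sub>F R in at_top. ennreal (real (pattern_count F V (points lam) (cube R)) / R ^ CARD('d))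
          = of_nat (pattern_count F V (points lam) (cube R)) / emeasure lborel (cube R :: (real^'d) set)"
        using eventually_gt_at_top[of 0]
        by eventually_elim
          (simp add: emeasure_lborel_cube divide_ennreal ennreal_of_nat_eq_real_of_nat)
      ultimately show "((\<lambda>R. of_nat (pattern_count F V (points lam) (cube R))
          / emeasure lborel (cube R :: (real^'d) set)) \<longlongrightarrow> palm mu X B (pattern_set X F V)) at_top"
        unfolding palm by (rule Lim_transform_eventually)
    qed
  qed
qed

theorem proposition14:
  fixes m :: nat and r :: real
    and X :: "((real^'d) \<times> nat) measure set"
    and mu :: "((real^'d) \<times> nat) measure measure"
    and F :: "((real^'d) \<times> nat) set" and V B :: "(real^'d) set"
  assumes "m \<ge> 1" and "r > 0"
    and "coloured_ergodic_point_process m r X mu"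
    and "is_pattern m r F V"
    and "bounded B" and "B \<in> sets borel" and "emeasure lborel B > 0"
  shows "(open V \<longrightarrow>
           (AE lam\<in>X in mu.
              Liminf at_top (\<lambda>R::real. of_nat (pattern_count F V (points lam) (cube R))
                                       / emeasure lborel (cube R :: (real^'d) set))
              = palm mu X B (pattern_set X F V)))
       \<and> (closed V \<longrightarrow>
           (AE lam\<in>X in mu.
              Limsup at_top (\<lambda>R::real. of_nat (pattern_count F V (points lam) (cube R))
                                       / emeasure lborel (cube R :: (real^'d) set))
              = palm mu X B (pattern_set X F V)))"
proof -
  note lim = pattern_density[OF assms(2-7)]
  \<comment> \<open>\<open>at_top\<close> is a nontrivial filter, so a limit along it is at once
    \<open>Liminf\<close> and \<open>Limsup\<close>.\<close>
  have "AE lam\<in>X in mu.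
      Liminf at_top (\<lambda>R::real. of_nat (pattern_count F V (points lam) (cube R))
        / emeasure lborel (cube R :: (real^'d) set)) = palm mu X B (pattern_set X F V)"
    using lim by eventually_elim (auto intro: lim_imp_Liminf)
  moreover have "AE lam\<in>X in mu.
      Limsup at_top (\<lambda>R::real. of_nat (pattern_count F V (points lam) (cube R))
        / emeasure lborel (cube R :: (real^'d) set)) = palm mu X B (pattern_set X F V)"
    using lim by eventually_elim (auto intro: lim_imp_Limsup)
  ultimately show ?thesis by blast
qed

end
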